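(* Fix an o-minimal structure on $(\mathbb{R},+,\cdot)$ and a positive integer $p$. Let $\Omega\subset\mathbb{R}^m$ and let $f\colon\Omega\to\mathbb{R}^n$ be a definable function (not necessarily continuous). Define $f^{-1}(0)^g:=\{x\in\mathbb{R}^m\mid (x,0)\in\overline{\Gamma_f}\}$. Then for any $a\in f^{-1}(0)^g$ there exist a neighbourhood $U$ of $a$ and an odd, strictly increasing, definable bijection $\phi\colon\mathbb{R}\to\mathbb{R}$ of class $\mathscr{C}^p$ which is $p$-flat at zero, such that $$\|f(x)\|\geq\phi\big(d(x,f^{-1}(0)^g)\big),\qquad x\in U\cap\Omega.$$
   Context: An o-minimal structure is a collection $\mathcal{S}=\{\mathcal{S}_n\}$, $\mathcal{S}_n$ a Boolean algebra of subsets of $\mathbb{R}^n$ containing all algebraic sets, closed under products and linear projections $\mathbb{R}^{n+1}\to\mathbb{R}^n$, with $\mathcal{S}_1$ consisting exactly of finite unions of points and intervals; elements are called definable, and a function is definable if its graph is. $\phi$ is $p$-flat at zero if $\phi^{(k)}(0)=0$ for $k=0,\dots,p$. $\Gamma_f$ is the graph of $f$, $\overline{\Gamma_f}$ its closure. *)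

theory Defs
  imports "HOL-Analysis.Analysis"
begin

definition Rn :: "nat \<Rightarrow> real list set" where
  "Rn k = {x. length x = k}"

definition lnorm :: "real list \<Rightarrow> real" where
  "lnorm x = sqrt (\<Sum>i<length x. (x ! i)^2)"

definition ldist :: "real list \<Rightarrow> real list \<Rightarrow> real" where
  "ldist x y = sqrt (\<Sum>i<length x. (x ! i - y ! i)^2)"

definition lclosure :: "nat \<Rightarrow> real list set \<Rightarrow> real list set" where
  "lclosure k G = {q \<in> Rn k. \<forall>e>0. \<exists>g\<in>G. ldist q g < e}"

definition lsetdist :: "real list \<Rightarrow> real list set \<Rightarrow> real" where
  "lsetdist x Z = Inf {ldist x z | z. z \<in> Z}"

inductive_set polyfun :: "nat \<Rightarrow> (real list \<Rightarrow> real) set" for k :: nat where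
  pconst: "(\<lambda>x. c) \<in> polyfun k"
| pvar: "i < k \<Longrightarrow> (\<lambda>x. x ! i) \<in> polyfun k"
| padd: "P \<in> polyfun k \<Longrightarrow> Q \<in> polyfun k \<Longrightarrow> (\<lambda>x. P x + Q x) \<in> polyfun k"
| pmult: "P \<in> polyfun k \<Longrightarrow> Q \<in> polyfun k \<Longrightarrow> (\<lambda>x. P x * Q x) \<in> polyfun k"

definition algebraic_set :: "nat \<Rightarrow> real list set \<Rightarrow> bool" where
  "algebraic_set k A \<longleftrightarrow>
     (\<exists>F. finite F \<and> F \<subseteq> polyfun k \<and> A = {x \<in> Rn k. \<forall>P\<in>F. P x = 0})"

definition point_or_interval :: "real set \<Rightarrow> bool" where
  "point_or_interval I \<longleftrightarrow>
     (\<exists>a. I = {a}) \<or> (\<exists>a b. a < b \<and> I = {a<..<b}) \<or> (\<exists>a. I = {a<..}) \<or>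
     (\<exists>b. I = {..<b}) \<or> I = UNIV"

definition finite_union_points_intervals :: "real set \<Rightarrow> bool" where
  "finite_union_points_intervals A \<longleftrightarrow>
     (\<exists>F. finite F \<and> (\<forall>I\<in>F. point_or_interval I) \<and> A = \<Union>F)"

text \<open>O-minimal structure on (R,+,*): S k is the family of definable subsets of R^k.\<close>
definition o_minimal :: "(nat \<Rightarrow> real list set set) \<Rightarrow> bool" where
  "o_minimal S \<longleftrightarrow>
     (\<forall>k. S k \<subseteq> Pow (Rn k)) \<and>
     (\<forall>k. {} \<in> S k) \<and>
     (\<forall>k A. A \<in> S k \<longrightarrow> Rn k - A \<in> S k) \<and>
     (\<forall>k A B. A \<in> S k \<longrightarrow> B \<in> S k \<longrightarrow> A \<union> B \<in> S k) \<and>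
     (\<forall>k A. algebraic_set k A \<longrightarrow> A \<in> S k) \<and>
     (\<forall>k l A B. A \<in> S k \<longrightarrow> B \<in> S l \<longrightarrow> {x @ y | x y. x \<in> A \<and> y \<in> B} \<in> S (k + l)) \<and>
     (\<forall>k A. A \<in> S (Suc k) \<longrightarrow> take k ` A \<in> S k) \<and>
     S 1 = {(\<lambda>t. [t]) ` A | A. finite_union_points_intervals A}"

definition lgraph :: "real list set \<Rightarrow> (real list \<Rightarrow> real list) \<Rightarrow> real list set" where
  "lgraph \<Omega> f = {x @ f x | x. x \<in> \<Omega>}"

definition definable_fun :: "(nat \<Rightarrow> real list set set) \<Rightarrow> nat \<Rightarrow> nat \<Rightarrow> real list set
     \<Rightarrow> (real list \<Rightarrow> real list) \<Rightarrow> bool" where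
  "definable_fun S m n \<Omega> f \<longleftrightarrow> \<Omega> \<subseteq> Rn m \<and> (\<forall>x\<in>\<Omega>. length (f x) = n) \<and> lgraph \<Omega> f \<in> S (m + n)"

definition definable_real_fun :: "(nat \<Rightarrow> real list set set) \<Rightarrow> (real \<Rightarrow> real) \<Rightarrow> bool" where
  "definable_real_fun S \<phi> \<longleftrightarrow> {[t, \<phi> t] | t. True} \<in> S 2"

definition gen_zero_set :: "nat \<Rightarrow> nat \<Rightarrow> real list set \<Rightarrow> (real list \<Rightarrow> real list) \<Rightarrow> real list set" where
  "gen_zero_set m n \<Omega> f = {x \<in> Rn m. x @ replicate n 0 \<in> lclosure (m + n) (lgraph \<Omega> f)}"

fun Ck :: "nat \<Rightarrow> (real \<Rightarrow> real) \<Rightarrow> bool" where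
  "Ck 0 g = continuous_on UNIV g"
| "Ck (Suc p) g = ((\<forall>t. g differentiable (at t)) \<and> Ck p (deriv g))"

definition p_flat_at_zero :: "nat \<Rightarrow> (real \<Rightarrow> real) \<Rightarrow> bool" where
  "p_flat_at_zero p g \<longleftrightarrow> (\<forall>k\<le>p. (deriv ^^ k) g 0 = 0)"

end

theory Submission
  imports Defs
begin

text \<open>
  Let \<open>Z\<close> be the generalised zero set and let \<open>g t\<close> be the infimum of 1 and the values \<open>\<parallel>f x\<parallel>\<close> over
  the \<open>x\<close> in the unit ball around \<open>a\<close> with \<open>d(x, Z) \<ge> t\<close>. The function \<open>g\<close> is definable and nondecreasing,
  and compactness makes it positive for \<open>t > 0\<close>. By o-minimality every definable \<open>h\<close> is differentiable
  near \<open>0+\<close>: all one-sided limits of difference quotients exist, the two one-sided derivatives differ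
  only on a countable set, and an infinite derivative cannot persist on an interval. Iterating, \<open>g\<close> is
  of class \<open>C^p\<close> on some \<open>(0, c)\<close> with \<open>c \<le> 1\<close>. Put \<open>\<phi> t = t \<bar>t\<bar>^p g(c\<bar>t\<bar> / (1 + \<bar>t\<bar>))\<close>. Since
  \<open>\<phi> = o(t^p)\<close> and a definable function that is \<open>o(t^(k+1))\<close> has a derivative that is \<open>o(t^k)\<close>, the
  function \<open>\<phi>\<close> is \<open>C^p\<close> and \<open>p\<close>-flat at 0, and \<open>\<phi> \<le> g\<close> on \<open>[0, 1]\<close>.
\<close>

section \<open>Definable predicates and terms\<close>

lemma polyfun_diff:
  assumes "P \<in> polyfun k" "Q \<in> polyfun k"
  shows "(\<lambda>x. P x - Q x) \<in> polyfun k"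
  using polyfun.padd[OF assms(1) polyfun.pmult[OF polyfun.pconst[of "-1"] assms(2)]] by simp

lemma polyfun_take: "T \<in> polyfun k \<Longrightarrow> (\<lambda>z. T (take k z)) \<in> polyfun (Suc k)"
  by (induction rule: polyfun.induct) (auto intro!: polyfun.intros)

text \<open>This form quantifies over reals only, so for definable \<open>h\<close> it is a
  definable condition on \<open>x\<close> and \<open>D\<close>. Clearing the denominator makes the
  case \<open>y = x\<close> harmless.\<close>

lemma has_real_derivative_iff_eps:
  fixes h :: "real \<Rightarrow> real"
  shows "(h has_real_derivative D) (at x) \<longleftrightarrow> (\<forall>e. 0 < e \<longrightarrow> (\<exists>d. 0 < d \<and> (\<forall>y. \<bar>y - x\<bar> < d \<longrightarrow>
      \<bar>h y - h x - (y - x) * D\<bar> \<le> e * \<bar>y - x\<bar>)))"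
  unfolding has_field_derivative_def has_derivative_at_alt
  by (auto simp: mult.commute[of D] bounded_linear_mult_right)

locale ominimal =
  fixes S :: "nat \<Rightarrow> real list set set"
  assumes omin: "o_minimal S"
begin

text \<open>The environment of the free variables is a list, and a quantifier binds a new last entry; hence the
  \<open>take k\<close> in \<open>defterm\<close> and in the quantifier rules.\<close>
definition defpred :: "nat \<Rightarrow> (real list \<Rightarrow> bool) \<Rightarrow> bool" where
  "defpred k P \<longleftrightarrow> {x \<in> Rn k. P x} \<in> S k"

definition defterm :: "nat \<Rightarrow> (real list \<Rightarrow> real) \<Rightarrow> bool" where
  "defterm k T \<longleftrightarrow> defpred (Suc k) (\<lambda>z. z ! k = T (take k z))"

section \<open>Boolean operations, quantifiers and substitution\<close>

lemma S_subset: "A \<in> S k \<Longrightarrow> A \<subseteq> Rn k"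
  and S_compl: "A \<in> S k \<Longrightarrow> Rn k - A \<in> S k"
  and S_Un: "A \<in> S k \<Longrightarrow> B \<in> S k \<Longrightarrow> A \<union> B \<in> S k"
  and S_algebraic: "algebraic_set k A \<Longrightarrow> A \<in> S k"
  and S_times: "A \<in> S k \<Longrightarrow> B \<in> S l \<Longrightarrow> {x @ y | x y. x \<in> A \<and> y \<in> B} \<in> S (k + l)"
  and S_proj: "A \<in> S (Suc k) \<Longrightarrow> take k ` A \<in> S k"
  and S_1: "S 1 = {(\<lambda>t. [t]) ` A | A. finite_union_points_intervals A}"
  using omin unfolding o_minimal_def by (simp_all add: subset_iff)

lemma defpred_cong:
  assumes "\<And>x. length x = k \<Longrightarrow> P x = Q x"
  shows "defpred k P = defpred k Q"
proof -
  have "{x \<in> Rn k. P x} = {x \<in> Rn k. Q x}"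
    using assms by (auto simp: Rn_def)
  then show ?thesis by (simp add: defpred_def)
qed

lemma defpred_not: "defpred k P \<Longrightarrow> defpred k (\<lambda>x. \<not> P x)"
proof -
  assume "defpred k P"
  then have "Rn k - {x \<in> Rn k. P x} \<in> S k"
    unfolding defpred_def by (rule S_compl)
  also have "Rn k - {x \<in> Rn k. P x} = {x \<in> Rn k. \<not> P x}" by auto
  finally show ?thesis by (simp add: defpred_def)
qed

lemma defpred_disj: "defpred k P \<Longrightarrow> defpred k Q \<Longrightarrow> defpred k (\<lambda>x. P x \<or> Q x)"
proof -
  assume "defpred k P" "defpred k Q"
  then have "{x \<in> Rn k. P x} \<union> {x \<in> Rn k. Q x} \<in> S k"
    unfolding defpred_def by (rule S_Un)
  also have "{x \<in> Rn k. P x} \<union> {x \<in> Rn k. Q x} = {x \<in> Rn k. P x \<or> Q x}" by auto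
  finally show ?thesis by (simp add: defpred_def)
qed

lemma defpred_conj: "defpred k P \<Longrightarrow> defpred k Q \<Longrightarrow> defpred k (\<lambda>x. P x \<and> Q x)"
  using defpred_not[OF defpred_disj[OF defpred_not defpred_not, of k P Q]] by simp

lemma defpred_imp: "defpred k P \<Longrightarrow> defpred k Q \<Longrightarrow> defpred k (\<lambda>x. P x \<longrightarrow> Q x)"
  unfolding imp_conv_disj by (intro defpred_disj defpred_not)

lemma defpred_algebraic:
  assumes "finite F" "F \<subseteq> polyfun k"
  shows "defpred k (\<lambda>x. \<forall>P\<in>F. P x = 0)"
proof -
  have "algebraic_set k {x \<in> Rn k. \<forall>P\<in>F. P x = 0}"
    using assms unfolding algebraic_set_def by (intro exI[of _ F]) auto
  then show ?thesis
    unfolding defpred_def by (rule S_algebraic)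
qed

lemma defpred_True: "defpred k (\<lambda>x. True)"
  using defpred_algebraic[of "{}" k] by simp

lemma defpred_ball_finite:
  assumes "finite I" "\<And>i. i \<in> I \<Longrightarrow> defpred k (P i)"
  shows "defpred k (\<lambda>x. \<forall>i\<in>I. P i x)"
  using assms
proof (induction I)
  case empty
  then show ?case using defpred_True by simp
next
  case (insert i I)
  then show ?case using defpred_conj[of k "P i" "\<lambda>x. \<forall>i\<in>I. P i x"] by simp
qed

text \<open>Existential quantification over the last coordinate is the projection axiom.\<close>

lemma defpred_ex_append:
  assumes "defpred (Suc k) P"
  shows "defpred k (\<lambda>x. \<exists>t. P (x @ [t]))"
proof -
  have "take k ` {z \<in> Rn (Suc k). P z} \<in> S k"
    using assms unfolding defpred_def by (rule S_proj)
  also have "take k ` {z \<in> Rn (Suc k). P z} = {x \<in> Rn k. \<exists>t. P (x @ [t])}"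
  proof (intro set_eqI iffI)
    fix x assume "x \<in> take k ` {z \<in> Rn (Suc k). P z}"
    then obtain z where z: "length z = Suc k" "P z" "x = take k z" by (auto simp: Rn_def)
    then have "z = x @ [z ! k]"
      by (metis lessI order_refl take_Suc_conv_app_nth take_all)
    then show "x \<in> {x \<in> Rn k. \<exists>t. P (x @ [t])}"
      using z by (auto simp: Rn_def intro!: exI[of _ "z ! k"])
  next
    fix x assume "x \<in> {x \<in> Rn k. \<exists>t. P (x @ [t])}"
    then obtain t where "length x = k" "P (x @ [t])" by (auto simp: Rn_def)
    then show "x \<in> take k ` {z \<in> Rn (Suc k). P z}"
      by (intro image_eqI[of _ _ "x @ [t]"]) (auto simp: Rn_def)
  qed
  finally show ?thesis by (simp add: defpred_def)
qed

text \<open>The form that \<open>intro\<close> can use: the conclusion matches any existential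
  formula, and in the premise the bound variable reappears as \<open>z ! k\<close> and the old
  environment as \<open>take k z\<close>.\<close>

lemma defpred_ex:
  assumes "defpred (Suc k) (\<lambda>z. P (take k z) (z ! k))"
  shows "defpred k (\<lambda>x. \<exists>t. P x t)"
proof -
  have "defpred k (\<lambda>x. \<exists>t. P (take k (x @ [t])) ((x @ [t]) ! k))"
    by (rule defpred_ex_append[OF assms])
  then show ?thesis
    by (rule iffD1[OF defpred_cong, rotated]) (auto simp: nth_append)
qed

lemma defpred_all:
  assumes "defpred (Suc k) (\<lambda>z. P (take k z) (z ! k))"
  shows "defpred k (\<lambda>x. \<forall>t. P x t)"
  using defpred_not[OF defpred_ex[OF defpred_not[OF assms]]] by simp

lemma defpred_ex_vec_append:
  assumes "defpred (k + m) P"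
  shows "defpred k (\<lambda>x. \<exists>y. length y = m \<and> P (x @ y))"
  using assms
proof (induction m arbitrary: P)
  case (Suc m)
  then have "defpred (k + m) (\<lambda>w. \<exists>t. P (w @ [t]))"
    using defpred_ex_append by simp
  from Suc.IH[OF this] show ?case
  proof (rule iffD1[OF defpred_cong, rotated])
    fix x :: "real list"
    show "(\<exists>y. length y = m \<and> (\<exists>t. P ((x @ y) @ [t]))) \<longleftrightarrow> (\<exists>y. length y = Suc m \<and> P (x @ y))"
      unfolding length_Suc_conv_rev append_assoc by auto
  qed
qed simp

lemma defpred_ex_vec:
  assumes "defpred (k + m) (\<lambda>w. P (take k w) (drop k w))"
  shows "defpred k (\<lambda>x. \<exists>y. length y = m \<and> P x y)"
proof -
  have "defpred k (\<lambda>x. \<exists>y. length y = m \<and> P (take k (x @ y)) (drop k (x @ y)))"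
    by (rule defpred_ex_vec_append[OF assms])
  then show ?thesis
    by (rule iffD1[OF defpred_cong, rotated]) auto
qed

text \<open>The set in question is the cylinder \<open>Rn k\<close> times \<open>A\<close>. Together
  with \<open>defpred_ex_vec\<close> this allows quantification over the points of a definable
  set.\<close>

lemma defpred_drop_mem:
  assumes "A \<in> S m"
  shows "defpred (k + m) (\<lambda>w. drop k w \<in> A)"
proof -
  have "Rn k \<in> S k" using defpred_True[of k] by (simp add: defpred_def)
  moreover have sub: "A \<subseteq> Rn m"
    using assms by (rule S_subset)
  ultimately have "{x @ y | x y. x \<in> Rn k \<and> y \<in> A} \<in> S (k + m)"
    using assms by (intro S_times)
  also have "{x @ y | x y. x \<in> Rn k \<and> y \<in> A} = {w \<in> Rn (k + m). drop k w \<in> A}"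
  proof (intro set_eqI iffI)
    fix w assume "w \<in> {w \<in> Rn (k + m). drop k w \<in> A}"
    then have "w = take k w @ drop k w" "take k w \<in> Rn k" "drop k w \<in> A"
      by (auto simp: Rn_def)
    then show "w \<in> {x @ y | x y. x \<in> Rn k \<and> y \<in> A}" by blast
  next
    fix w assume "w \<in> {x @ y | x y. x \<in> Rn k \<and> y \<in> A}"
    then show "w \<in> {w \<in> Rn (k + m). drop k w \<in> A}"
      using sub by (auto simp: Rn_def)
  qed
  finally show ?thesis by (simp add: defpred_def)
qed

text \<open>Coordinates may be permuted, repeated or dropped: append a vector \<open>y\<close> of
  \<open>j\<close> new coordinates, tie it to the chosen entries of \<open>x\<close> by linear
  equations, impose \<open>P\<close> on \<open>y\<close>, and project \<open>y\<close> away.\<close>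

lemma defpred_reindex:
  assumes "defpred j P" "length is = j" "\<And>i. i \<in> set is \<Longrightarrow> i < k"
  shows "defpred k (\<lambda>x. P (map ((!) x) is))"
proof -
  let ?F = "(\<lambda>l w. w ! (k + l) - w ! (is ! l)) ` {..<j}"
  have "?F \<subseteq> polyfun (k + j)"
    using assms(2,3)
    by (auto intro!: polyfun_diff polyfun.intros simp: trans_less_add1)
  then have "defpred (k + j) (\<lambda>w. \<forall>p\<in>?F. p w = 0)"
    by (intro defpred_algebraic) auto
  moreover have "defpred (k + j) (\<lambda>w. drop k w \<in> {y \<in> Rn j. P y})"
    using assms(1) by (intro defpred_drop_mem) (simp add: defpred_def)
  ultimately have "defpred (k + j) (\<lambda>w. drop k w \<in> {y \<in> Rn j. P y} \<and> (\<forall>p\<in>?F. p w = 0))"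
    by (intro defpred_conj)
  from defpred_ex_vec_append[OF this] show ?thesis
  proof (rule iffD1[OF defpred_cong, rotated])
    fix x :: "real list" assume x: "length x = k"
    have eq: "(\<forall>p\<in>?F. p (x @ y) = 0) \<longleftrightarrow> y = map ((!) x) is" if "length y = j" for y
      using x assms(2,3) that by (auto simp: list_eq_iff_nth_eq nth_append)
    show "(\<exists>y. length y = j \<and> drop k (x @ y) \<in> {y \<in> Rn j. P y} \<and> (\<forall>p\<in>?F. p (x @ y) = 0))
        \<longleftrightarrow> P (map ((!) x) is)"
      using x eq assms(2,3) by (auto simp: Rn_def nth_append intro!: exI[of _ "map ((!) x) is"])
  qed
qed

text \<open>By definition the value of a term sits right after its arguments; reindexing moves it to
  any coordinate of a longer environment.\<close>

lemma defterm_graph_at: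
  assumes "defterm k T" "k \<le> l" "i < l"
  shows "defpred l (\<lambda>w. w ! i = T (take k w))"
proof -
  have "defpred l (\<lambda>w. map ((!) w) ([0..<k] @ [i]) ! k = T (take k (map ((!) w) ([0..<k] @ [i]))))"
    using assms by (intro defpred_reindex[of "Suc k"]) (auto simp: defterm_def)
  then show ?thesis
  proof (rule iffD1[OF defpred_cong, rotated])
    fix w :: "real list" assume w: "length w = l"
    have "map ((!) w) [0..<k] = take k w"
      using w assms(2) by (auto simp: list_eq_iff_nth_eq)
    then show "(map ((!) w) ([0..<k] @ [i]) ! k = T (take k (map ((!) w) ([0..<k] @ [i])))) =
        (w ! i = T (take k w))"
      using w assms(2) by (simp add: nth_append)
  qed
qed

lemma defterm_take: "defterm k T \<Longrightarrow> defterm (Suc k) (\<lambda>z. T (take k z))"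
  unfolding defterm_def[of "Suc k"]
  by (rule iffD2[OF defpred_cong defterm_graph_at]) auto

lemma defterm_poly:
  assumes "T \<in> polyfun k"
  shows "defterm k T"
proof -
  have "{\<lambda>z. z ! k - T (take k z)} \<subseteq> polyfun (Suc k)"
    using polyfun_take[OF assms] by (auto intro!: polyfun_diff polyfun.intros)
  from defpred_algebraic[OF _ this] show ?thesis
    unfolding defterm_def by (auto elim!: iffD1[OF defpred_cong, rotated])
qed

lemma defterm_const: "defterm k (\<lambda>x. c)"
  by (intro defterm_poly polyfun.intros)

lemma defterm_var: "i < k \<Longrightarrow> defterm k (\<lambda>x. x ! i)"
  by (intro defterm_poly polyfun.intros)

text \<open>The same elimination as in \<open>defpred_reindex\<close>, with the graphs of the terms
  \<open>Ts\<close> in place of the linear equations.\<close>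

lemma defpred_subst:
  assumes "defpred j P" "length Ts = j" "\<And>T. T \<in> set Ts \<Longrightarrow> defterm k T"
  shows "defpred k (\<lambda>x. P (map (\<lambda>T. T x) Ts))"
proof -
  have "defpred (k + j) (\<lambda>w. \<forall>l\<in>{..<j}. w ! (k + l) = (Ts ! l) (take k w))"
    using assms(2,3) by (intro defpred_ball_finite defterm_graph_at) auto
  moreover have "defpred (k + j) (\<lambda>w. drop k w \<in> {y \<in> Rn j. P y})"
    using assms(1) by (intro defpred_drop_mem) (simp add: defpred_def)
  ultimately have "defpred (k + j) (\<lambda>w. drop k w \<in> {y \<in> Rn j. P y} \<and>
      (\<forall>l\<in>{..<j}. w ! (k + l) = (Ts ! l) (take k w)))"
    by (intro defpred_conj)
  from defpred_ex_vec_append[OF this] show ?thesis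
  proof (rule iffD1[OF defpred_cong, rotated])
    fix x :: "real list" assume x: "length x = k"
    have eq: "(\<forall>l\<in>{..<j}. (x @ y) ! (k + l) = (Ts ! l) (take k (x @ y))) \<longleftrightarrow> y = map (\<lambda>T. T x) Ts"
      if "length y = j" for y
      using x assms(2) that by (auto simp: list_eq_iff_nth_eq nth_append)
    show "(\<exists>y. length y = j \<and> drop k (x @ y) \<in> {y \<in> Rn j. P y} \<and>
        (\<forall>l\<in>{..<j}. (x @ y) ! (k + l) = (Ts ! l) (take k (x @ y)))) \<longleftrightarrow> P (map (\<lambda>T. T x) Ts)"
      using x eq assms(2) by (auto simp: Rn_def intro!: exI[of _ "map (\<lambda>T. T x) Ts"])
  qed
qed

lemma defpred_rel2:
  assumes "defpred 2 (\<lambda>y. R (y ! 0) (y ! 1))" "defterm k T" "defterm k U"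
  shows "defpred k (\<lambda>x. R (T x) (U x))"
  using defpred_subst[OF assms(1), of "[T, U]" k] assms(2,3) by auto

lemma defterm_op1:
  assumes "defpred 2 (\<lambda>y. y ! 1 = h (y ! 0))" "defterm k T"
  shows "defterm k (\<lambda>x. h (T x))"
  unfolding defterm_def
  by (rule defpred_rel2[OF assms(1) defterm_take[OF assms(2)] defterm_var]) simp

lemma defterm_op2:
  assumes "defpred 3 (\<lambda>y. y ! 2 = h (y ! 0) (y ! 1))" "defterm k T" "defterm k U"
  shows "defterm k (\<lambda>x. h (T x) (U x))"
  unfolding defterm_def
  using defpred_subst[OF assms(1), of "[\<lambda>z. T (take k z), \<lambda>z. U (take k z), \<lambda>z. z ! k]" "Suc k"]
    defterm_take[OF assms(2)] defterm_take[OF assms(3)] defterm_var[of k "Suc k"]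
  by (auto simp: numeral_3_eq_3)

section \<open>Equations, arithmetic and order\<close>

lemma defpred_poly_eq_0: "T \<in> polyfun k \<Longrightarrow> defpred k (\<lambda>x. T x = 0)"
  using defpred_algebraic[of "{T}" k] by simp

lemma defpred_eq:
  assumes "defterm k T" "defterm k U"
  shows "defpred k (\<lambda>x. T x = U x)"
proof (rule defpred_rel2[OF _ assms])
  have "defpred 2 (\<lambda>y. y ! 0 - y ! 1 = 0)"
    by (intro defpred_poly_eq_0 polyfun_diff polyfun.intros) auto
  then show "defpred 2 (\<lambda>y. y ! 0 = y ! 1)" by simp
qed

lemma defterm_add:
  assumes "defterm k T" "defterm k U"
  shows "defterm k (\<lambda>x. T x + U x)"
proof (rule defterm_op2[OF _ assms])
  show "defpred 3 (\<lambda>y. y ! 2 = y ! 0 + y ! 1)"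
    by (intro defpred_eq defterm_poly polyfun.intros) auto
qed

lemma defterm_mult:
  assumes "defterm k T" "defterm k U"
  shows "defterm k (\<lambda>x. T x * U x)"
proof (rule defterm_op2[OF _ assms])
  show "defpred 3 (\<lambda>y. y ! 2 = y ! 0 * y ! 1)"
    by (intro defpred_eq defterm_poly polyfun.intros) auto
qed

lemma defterm_minus: "defterm k T \<Longrightarrow> defterm k (\<lambda>x. - T x)"
  using defterm_mult[OF defterm_const[of k "-1"]] by simp

lemma defterm_diff: "defterm k T \<Longrightarrow> defterm k U \<Longrightarrow> defterm k (\<lambda>x. T x - U x)"
  using defterm_add[OF _ defterm_minus] by simp

lemma defterm_power: "defterm k T \<Longrightarrow> defterm k (\<lambda>x. T x ^ n)"
  by (induction n) (auto intro: defterm_const defterm_mult)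

lemma defterm_sum:
  assumes "\<And>i. i \<in> I \<Longrightarrow> defterm k (T i)"
  shows "defterm k (\<lambda>x. \<Sum>i\<in>I. T i x)"
  using assms by (induction I rule: infinite_finite_induct) (auto intro: defterm_const defterm_add)

text \<open>Algebraic sets supply only equations; the order is recovered because a real number is
  positive exactly when its product with some square equals 1.\<close>

lemma defpred_less:
  assumes "defterm k T" "defterm k U"
  shows "defpred k (\<lambda>x. T x < U x)"
proof (rule defpred_rel2[OF _ assms])
  have "defpred 2 (\<lambda>y. \<exists>t. (y ! 1 - y ! 0) * t\<^sup>2 = 1)"
    by (intro defpred_ex defpred_eq defterm_mult defterm_diff defterm_power defterm_const) (auto intro: defterm_var)
  moreover have "(\<exists>t. (b - a) * t\<^sup>2 = 1) \<longleftrightarrow> a < b" for a b :: real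
  proof
    assume "\<exists>t. (b - a) * t\<^sup>2 = 1"
    then obtain t where "(b - a) * t\<^sup>2 = 1" by blast
    then have "0 < (b - a) * t\<^sup>2" by simp
    then show "a < b" by (simp add: zero_less_mult_iff)
  next
    assume "a < b"
    then have "(b - a) * (1 / sqrt (b - a))\<^sup>2 = 1" by (simp add: power_divide)
    then show "\<exists>t. (b - a) * t\<^sup>2 = 1" by blast
  qed
  ultimately show "defpred 2 (\<lambda>y. y ! 0 < y ! 1)" by simp
qed

lemma defpred_le: "defterm k T \<Longrightarrow> defterm k U \<Longrightarrow> defpred k (\<lambda>x. T x \<le> U x)"
  using defpred_not[OF defpred_less, of k U T] by (simp add: not_less)

lemma defterm_divide:
  assumes "defterm k T" "defterm k U"
  shows "defterm k (\<lambda>x. T x / U x)"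
proof (rule defterm_op2[OF _ assms])
  \<comment> \<open>The first disjunct encodes the convention that division by 0 yields 0.\<close>
  have "defpred 3 (\<lambda>y. (y ! 1 = 0 \<and> y ! 2 = 0) \<or> (\<not> y ! 1 = 0 \<and> y ! 2 * y ! 1 = y ! 0))"
    by (intro defpred_disj defpred_conj defpred_not defpred_eq defterm_mult defterm_const defterm_var) auto
  then show "defpred 3 (\<lambda>y. y ! 2 = y ! 0 / y ! 1)"
    by (rule iffD1[OF defpred_cong, rotated]) (auto simp: field_simps split: if_splits)
qed

lemma defterm_abs:
  assumes "defterm k T"
  shows "defterm k (\<lambda>x. \<bar>T x\<bar>)"
proof (rule defterm_op1[OF _ assms])
  have "defpred 2 (\<lambda>y. (0 \<le> y ! 0 \<and> y ! 1 = y ! 0) \<or> (y ! 0 < 0 \<and> y ! 1 = - y ! 0))"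
    by (intro defpred_disj defpred_conj defpred_le defpred_less defpred_eq defterm_minus defterm_const defterm_var) auto
  then show "defpred 2 (\<lambda>y. y ! 1 = \<bar>y ! 0\<bar>)"
    by (rule iffD1[OF defpred_cong, rotated]) auto
qed

lemma definable_real_fun_iff: "definable_real_fun S h \<longleftrightarrow> defpred 2 (\<lambda>y. y ! 1 = h (y ! 0))"
proof -
  have "{[t, h t] | t. True} = {y \<in> Rn 2. y ! 1 = h (y ! 0)}"
    by (auto simp: Rn_def numeral_2_eq_2 length_Suc_conv)
  then show ?thesis by (simp add: definable_real_fun_def defpred_def)
qed

lemma defterm_fun: "definable_real_fun S h \<Longrightarrow> defterm k T \<Longrightarrow> defterm k (\<lambda>x. h (T x))"
  by (rule defterm_op1) (auto simp: definable_real_fun_iff)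

lemma definable_real_funI: "defterm 1 (\<lambda>x. h (x ! 0)) \<Longrightarrow> definable_real_fun S h"
  by (simp add: definable_real_fun_iff defterm_def numeral_2_eq_2)

lemmas defpred_intros = defpred_not defpred_disj defpred_conj defpred_imp defpred_ex defpred_all defpred_eq defpred_less defpred_le
lemmas defterm_intros = defterm_add defterm_mult defterm_minus defterm_diff defterm_power defterm_sum defterm_divide defterm_abs defterm_const

lemma definable_deriv:
  assumes "definable_real_fun S h"
  shows "definable_real_fun S (deriv h)"
proof -
  define HD where "HD x D \<longleftrightarrow> (\<forall>e. 0 < e \<longrightarrow> (\<exists>d. 0 < d \<and> (\<forall>y. \<bar>y - x\<bar> < d \<longrightarrow>
      \<bar>h y - h x - (y - x) * D\<bar> \<le> e * \<bar>y - x\<bar>)))" for x D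
  have HD: "(h has_real_derivative D) (at x) \<longleftrightarrow> HD x D" for x D
    unfolding has_real_derivative_iff_eps HD_def ..
  \<comment> \<open>\<open>deriv\<close> is a Hilbert choice. Where no derivative exists, the
    predicate chosen from is constantly false, so all such points receive the same value
    \<open>c\<close>, and the total function \<open>deriv h\<close> is definable.\<close>
  define c :: real where "c = (SOME D. False)"
  have "deriv h x = D \<longleftrightarrow> HD x D \<or> (\<not> (\<exists>E. HD x E) \<and> D = c)" for x D
  proof (cases "\<exists>E. HD x E")
    case True
    then show ?thesis by (metis HD DERIV_imp_deriv)
  next
    case False
    then have "(\<lambda>D. (h has_real_derivative D) (at x)) = (\<lambda>D. False)"
      using HD by auto
    then have "deriv h x = c" unfolding deriv_def c_def by simp
    then show ?thesis using False by auto
  qed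
  then have eq: "y = deriv h x \<longleftrightarrow> HD x y \<or> (\<not> (\<exists>E. HD x E) \<and> y = c)" for x y by metis
  show ?thesis
    unfolding definable_real_fun_iff eq unfolding HD_def
    by (intro defpred_intros defterm_intros defterm_fun[OF assms]) (auto intro: defterm_var)
qed

end

section \<open>Differentiability of definable functions\<close>

text \<open>A one-sided filter decides every comparison with a constant. Being decided is preserved
  by negation and conjunction, and points and intervals are built from comparisons in this
  way.\<close>

lemma point_or_interval_dichotomy:
  fixes x :: real
  assumes "F = at_right x \<or> F = at_left x" "point_or_interval I"
  shows "(\<forall>\<^sub>F y in F. y \<in> I) \<or> (\<forall>\<^sub>F y in F. y \<notin> I)"
proof -
  have trich: "(\<forall>\<^sub>F y in F. y < b) \<or> (\<forall>\<^sub>F y in F. b < y)" for b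
    using assms(1)
  proof
    assume F: "F = at_right x"
    have "\<forall>\<^sub>F y in at_right x. b < y" if "b \<le> x"
      using eventually_at_right_less[of x] by (rule eventually_mono) (use that in auto)
    moreover have "\<forall>\<^sub>F y in at_right x. y < b" if "b > x"
      using that by (auto intro: eventually_at_rightI[of x b])
    ultimately show ?thesis unfolding F by fastforce
  next
    assume F: "F = at_left x"
    have "\<forall>\<^sub>F y in at_left x. y < b" if "x \<le> b"
      using that by (intro eventually_at_leftI[of "x - 1" x]) auto
    moreover have "\<forall>\<^sub>F y in at_left x. b < y" if "b < x"
      using that by (auto intro: eventually_at_leftI[of b x])
    ultimately show ?thesis unfolding F by fastforce
  qed
  have half: "(\<forall>\<^sub>F y in F. y < b) \<or> (\<forall>\<^sub>F y in F. \<not> y < b)"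
    "(\<forall>\<^sub>F y in F. b < y) \<or> (\<forall>\<^sub>F y in F. \<not> b < y)" for b
    using trich[of b] by (meson eventually_mono less_asym)+
  have conj: "(\<forall>\<^sub>F y in F. P y \<and> Q y) \<or> (\<forall>\<^sub>F y in F. \<not> (P y \<and> Q y))"
    if "(\<forall>\<^sub>F y in F. P y) \<or> (\<forall>\<^sub>F y in F. \<not> P y)" "(\<forall>\<^sub>F y in F. Q y) \<or> (\<forall>\<^sub>F y in F. \<not> Q y)" for P Q
  proof -
    have np: ?thesis if "\<forall>\<^sub>F y in F. \<not> P y"
      using eventually_mono[OF that, of "\<lambda>y. \<not> (P y \<and> Q y)"] by simp
    have nq: ?thesis if "\<forall>\<^sub>F y in F. \<not> Q y"
      using eventually_mono[OF that, of "\<lambda>y. \<not> (P y \<and> Q y)"] by simp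
    have pq: ?thesis if "\<forall>\<^sub>F y in F. P y" "\<forall>\<^sub>F y in F. Q y"
      using eventually_conj[OF that] by simp
    from that show ?thesis using np nq pq by satx
  qed
  have not: "(\<forall>\<^sub>F y in F. \<not> P y) \<or> (\<forall>\<^sub>F y in F. \<not> \<not> P y)"
    if "(\<forall>\<^sub>F y in F. P y) \<or> (\<forall>\<^sub>F y in F. \<not> P y)" for P
    using that by auto
  from assms(2) show ?thesis unfolding point_or_interval_def
  proof (elim disjE exE conjE)
    fix a assume I: "I = {a}"
    have "y \<in> I \<longleftrightarrow> \<not> y < a \<and> \<not> a < y" for y using I by auto
    then show ?thesis using conj[OF not[OF half(1)] not[OF half(2)], of a a] by simp
  next
    fix a b assume "I = {a<..<b}"
    then show ?thesis using conj[OF half(2) half(1), of a b] by simp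
  qed (use half in auto)
qed

lemma finite_union_dichotomy:
  fixes x :: real
  assumes F: "F = at_right x \<or> F = at_left x" and "finite_union_points_intervals A"
  shows "(\<forall>\<^sub>F y in F. y \<in> A) \<or> (\<forall>\<^sub>F y in F. y \<notin> A)"
proof -
  obtain C where C: "finite C" "\<And>I. I \<in> C \<Longrightarrow> point_or_interval I" "A = \<Union>C"
    using assms(2) unfolding finite_union_points_intervals_def by blast
  show ?thesis
  proof (cases "\<exists>I\<in>C. \<forall>\<^sub>F y in F. y \<in> I")
    case True
    then show ?thesis unfolding C(3) by (auto elim: eventually_mono)
  next
    case False
    then have "\<forall>\<^sub>F y in F. \<forall>I\<in>C. y \<notin> I"
      using C point_or_interval_dichotomy[OF F] by (intro eventually_ball_finite) blast+
    then show ?thesis unfolding C(3) by (auto elim: eventually_mono)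
  qed
qed

text \<open>Each half-open cell of length \<open>d\<close> holds at most one point of
  \<open>A\<close>, so the index of the cell injects \<open>A\<close> into the integers.\<close>

lemma countable_separated_real:
  fixes A :: "real set"
  assumes "d > 0" "\<And>x y. x \<in> A \<Longrightarrow> y \<in> A \<Longrightarrow> \<bar>x - y\<bar> < d \<Longrightarrow> x = y"
  shows "countable A"
proof -
  have "inj_on (\<lambda>x. \<lfloor>x / d\<rfloor>) A"
  proof (rule inj_onI)
    fix x y assume xy: "x \<in> A" "y \<in> A" "\<lfloor>x / d\<rfloor> = \<lfloor>y / d\<rfloor>"
    have "\<bar>x / d - y / d\<bar> < 1" using xy(3) by linarith
    then have "\<bar>x - y\<bar> < d" using assms(1) by (simp add: diff_divide_distrib[symmetric] abs_divide)
    then show "x = y" using assms(2) xy by blast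
  qed
  then show ?thesis by (rule countableI')
qed

text \<open>Fix the slope \<open>q\<close> and the radius. Two such points closer than the radius
  would each lie strictly below the other after tilting, so the points are separated. Only countably
  many pairs of \<open>q\<close> and \<open>k\<close> occur.\<close>

lemma countable_strict_local_min:
  fixes u :: "real \<Rightarrow> real"
  shows "countable {x. \<exists>q::rat. \<exists>k::nat. \<forall>y. y \<noteq> x \<longrightarrow> \<bar>y - x\<bar> < inverse (Suc k) \<longrightarrow>
    u x - of_rat q * x < u y - of_rat q * y}" (is "countable ?A")
proof -
  define B where "B q k = {x. \<forall>y. y \<noteq> x \<longrightarrow> \<bar>y - x\<bar> < inverse (Suc k) \<longrightarrow>
    u x - of_rat q * x < u y - of_rat q * y}" for q :: rat and k :: nat
  have "countable (B q k)" for q k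
  proof (rule countable_separated_real)
    show "0 < inverse (real (Suc k))" by simp
    fix x y assume xy: "x \<in> B q k" "y \<in> B q k" "\<bar>x - y\<bar> < inverse (real (Suc k))"
    show "x = y"
    proof (rule ccontr)
      assume "x \<noteq> y"
      then have "u x - of_rat q * x < u y - of_rat q * y" "u y - of_rat q * y < u x - of_rat q * x"
        using xy unfolding B_def by (auto simp: abs_minus_commute)
      then show False by simp
    qed
  qed
  then have "countable (\<Union>q. \<Union>k. B q k)" by auto
  also have "(\<Union>q. \<Union>k. B q k) = ?A" unfolding B_def by auto
  finally show ?thesis .
qed

text \<open>The local hypothesis compares \<open>u\<close> only with its value at the centre
  \<open>x\<close>. This still orders the endpoints of every short interval containing
  \<open>x\<close>, by way of \<open>u x\<close>, and bisection chains such intervals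
  together.\<close>

lemma le_of_locally_increasing:
  fixes u :: "real \<Rightarrow> real"
  assumes "a \<le> b"
    and "\<And>x. a \<le> x \<Longrightarrow> x \<le> b \<Longrightarrow> \<exists>d>0. \<forall>y. \<bar>y - x\<bar> < d \<longrightarrow> 0 \<le> (u y - u x) * (y - x)"
  shows "u a \<le> u b"
  using assms(1)
proof (induction rule: Bolzano)
  case (local x)
  then obtain d where d: "d > 0" "\<And>y. \<bar>y - x\<bar> < d \<Longrightarrow> 0 \<le> (u y - u x) * (y - x)"
    using assms(2) by blast
  have "u s \<le> u t" if "s \<le> x" "x \<le> t" "t - s < d" for s t
  proof -
    have "u s \<le> u x"
      using d(2)[of s] that by (cases "s = x") (auto simp: zero_le_mult_iff)
    moreover have "u x \<le> u t"
      using d(2)[of t] that by (cases "t = x") (auto simp: zero_le_mult_iff)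
    ultimately show ?thesis by simp
  qed
  with d(1) show ?case by blast
qed auto

section \<open>One-sided limits and differentiability to the right of zero\<close>

context ominimal
begin

text \<open>The axiom for \<open>S 1\<close> enters here: definable sets of reals are finite unions
  of points and intervals, and one-sided filters decide those.\<close>

lemma defpred_dichotomy:
  fixes x :: real
  assumes F: "F = at_right x \<or> F = at_left x" and "defpred 1 (\<lambda>w. P (w ! 0))"
  shows "(\<forall>\<^sub>F y in F. P y) \<or> (\<forall>\<^sub>F y in F. \<not> P y)"
proof -
  obtain A where A: "{w \<in> Rn 1. P (w ! 0)} = (\<lambda>t. [t]) ` A" "finite_union_points_intervals A"
    using assms(2) unfolding defpred_def S_1 by blast
  have "P y \<longleftrightarrow> y \<in> A" for y
  proof -
    have "P y \<longleftrightarrow> [y] \<in> {w \<in> Rn 1. P (w ! 0)}" by (simp add: Rn_def)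
    also have "\<dots> \<longleftrightarrow> y \<in> A" unfolding A(1) by auto
    finally show ?thesis .
  qed
  then show ?thesis using finite_union_dichotomy[OF F A(2)] by simp
qed

text \<open>A real \<open>q\<close> strictly between the lower and the upper limit would make
  \<open>h y < q\<close> neither eventually true nor eventually false. The limit is extended real
  because \<open>h\<close> may be unbounded.\<close>

lemma definable_tendsto_ereal:
  fixes x :: real
  assumes F: "F = at_right x \<or> F = at_left x" and h: "definable_real_fun S h"
  obtains l where "((\<lambda>y. ereal (h y)) \<longlongrightarrow> l) F"
proof -
  have nb: "F \<noteq> bot" using F trivial_limit_at_right_real[of x] trivial_limit_at_left_real[of x] by metis
  have le: "Liminf F (\<lambda>y. ereal (h y)) \<le> Limsup F (\<lambda>y. ereal (h y))"
    by (rule Liminf_le_Limsup[OF nb])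
  moreover have "\<not> Liminf F (\<lambda>y. ereal (h y)) < Limsup F (\<lambda>y. ereal (h y))"
  proof
    assume "Liminf F (\<lambda>y. ereal (h y)) < Limsup F (\<lambda>y. ereal (h y))"
    then obtain q :: real where q: "Liminf F (\<lambda>y. ereal (h y)) < q" "q < Limsup F (\<lambda>y. ereal (h y))"
      using ereal_dense2 by blast
    have "defpred 1 (\<lambda>w. h (w ! 0) < q)"
      by (intro defpred_intros defterm_intros defterm_fun[OF h]) (auto intro: defterm_var)
    from defpred_dichotomy[OF F this] show False
    proof
      assume "\<forall>\<^sub>F y in F. h y < q"
      then have "Limsup F (\<lambda>y. ereal (h y)) \<le> q"
        by (intro Limsup_bounded) (auto elim: eventually_mono)
      then show False using q by simp
    next
      assume "\<forall>\<^sub>F y in F. \<not> h y < q"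
      then have "q \<le> Liminf F (\<lambda>y. ereal (h y))"
        by (intro Liminf_bounded) (auto elim: eventually_mono)
      then show False using q by simp
    qed
  qed
  ultimately have "Limsup F (\<lambda>y. ereal (h y)) = Liminf F (\<lambda>y. ereal (h y))"
    by simp
  then show ?thesis using that tendsto_iff_Liminf_eq_Limsup[OF nb] by metis
qed


text \<open>The difference quotient at \<open>x\<close> has a left limit \<open>L\<close> and a
  right limit \<open>R\<close>. If \<open>L < R\<close>, subtracting a line of rational slope
  between them creates a strict minimum; if \<open>R < L\<close>, the same works for
  \<open>-h\<close> with the negated slope. If \<open>L = R\<close> is finite, \<open>h\<close> is
  differentiable; if infinite, \<open>inf\<close> is violated. Multiplying the quotient by
  \<open>(y - x)\<^sup>2\<close> in \<open>inf\<close> treats both sides of \<open>x\<close>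
  alike.\<close>

lemma nondifferentiable_imp_strict_min_tilted:
  fixes x :: real
  assumes h: "definable_real_fun S h"
    and nd: "\<not> h differentiable at x"
    and inf: "\<And>s. s \<in> {1, -1} \<Longrightarrow>
      \<not> (\<forall>M. \<forall>\<^sub>F y in at x. M * (y - x)\<^sup>2 \<le> s * (h y - h x) * (y - x))"
  shows "\<exists>s\<in>{1, -1}. \<exists>q::rat. \<forall>\<^sub>F y in at x. s * h x - of_rat q * x < s * h y - of_rat q * y"
proof -
  define u where "u y = (h y - h x) / (y - x)" for y
  have "definable_real_fun S u"
    unfolding u_def
    by (rule definable_real_funI, intro defterm_intros defterm_fun[OF h]) (auto intro: defterm_var)
  then obtain L R where L: "((\<lambda>y. ereal (u y)) \<longlongrightarrow> L) (at_left x)"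
    and R: "((\<lambda>y. ereal (u y)) \<longlongrightarrow> R) (at_right x)"
    using definable_tendsto_ereal by metis
  have ueq: "h y - h x = u y * (y - x)" if "y \<noteq> x" for y
    using that by (simp add: u_def)
  consider "L < R" | "R < L" | "L = R" by fastforce
  then show ?thesis
  proof cases
    case 1
    then obtain q :: rat where q: "L < ereal (of_rat q)" "ereal (of_rat q) < R"
      using ereal_dense3 by blast
    have "\<forall>\<^sub>F y in at_left x. 1 * h x - of_rat q * x < 1 * h y - of_rat q * y"
    proof (rule eventually_mono[OF eventually_conj[OF order_tendstoD(2)[OF L q(1)]]])
      show "\<forall>\<^sub>F y in at_left x. y < x" by (auto intro: eventually_at_leftI[of "x - 1" x])
      fix y assume "ereal (u y) < ereal (of_rat q) \<and> y < x"
      then have "of_rat q * (y - x) < u y * (y - x)" by (intro mult_strict_right_mono_neg) auto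
      then show "1 * h x - of_rat q * x < 1 * h y - of_rat q * y"
        using ueq[of y] \<open>_ \<and> y < x\<close> by (simp add: algebra_simps)
    qed
    moreover have "\<forall>\<^sub>F y in at_right x. 1 * h x - of_rat q * x < 1 * h y - of_rat q * y"
    proof (rule eventually_mono[OF eventually_conj[OF order_tendstoD(1)[OF R q(2)]]])
      show "\<forall>\<^sub>F y in at_right x. x < y" by (rule eventually_at_right_less)
      fix y assume "ereal (of_rat q) < ereal (u y) \<and> x < y"
      then have "of_rat q * (y - x) < u y * (y - x)" by (intro mult_strict_right_mono) auto
      then show "1 * h x - of_rat q * x < 1 * h y - of_rat q * y"
        using ueq[of y] \<open>_ \<and> x < y\<close> by (simp add: algebra_simps)
    qed
    ultimately have "\<forall>\<^sub>F y in at x. 1 * h x - of_rat q * x < 1 * h y - of_rat q * y"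
      by (simp add: eventually_at_split)
    then show ?thesis by blast
  next
    case 2
    then obtain q :: rat where q: "R < ereal (of_rat q)" "ereal (of_rat q) < L"
      using ereal_dense3 by blast
    have "\<forall>\<^sub>F y in at_left x. -1 * h x - of_rat (-q) * x < -1 * h y - of_rat (-q) * y"
    proof (rule eventually_mono[OF eventually_conj[OF order_tendstoD(1)[OF L q(2)]]])
      show "\<forall>\<^sub>F y in at_left x. y < x" by (auto intro: eventually_at_leftI[of "x - 1" x])
      fix y assume "ereal (of_rat q) < ereal (u y) \<and> y < x"
      then have "u y * (y - x) < of_rat q * (y - x)" by (intro mult_strict_right_mono_neg) auto
      then show "-1 * h x - of_rat (-q) * x < -1 * h y - of_rat (-q) * y"
        using ueq[of y] \<open>_ \<and> y < x\<close> by (simp add: algebra_simps of_rat_minus)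
    qed
    moreover have "\<forall>\<^sub>F y in at_right x. -1 * h x - of_rat (-q) * x < -1 * h y - of_rat (-q) * y"
    proof (rule eventually_mono[OF eventually_conj[OF order_tendstoD(2)[OF R q(1)]]])
      show "\<forall>\<^sub>F y in at_right x. x < y" by (rule eventually_at_right_less)
      fix y assume "ereal (u y) < ereal (of_rat q) \<and> x < y"
      then have "u y * (y - x) < of_rat q * (y - x)" by (intro mult_strict_right_mono) auto
      then show "-1 * h x - of_rat (-q) * x < -1 * h y - of_rat (-q) * y"
        using ueq[of y] \<open>_ \<and> x < y\<close> by (simp add: algebra_simps of_rat_minus)
    qed
    ultimately have "\<forall>\<^sub>F y in at x. -1 * h x - of_rat (-q) * x < -1 * h y - of_rat (-q) * y"
      by (simp add: eventually_at_split)
    then show ?thesis by blast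
  next
    case 3
    then have lim: "((\<lambda>y. ereal (u y)) \<longlongrightarrow> L) (at x)"
      using L R filterlim_at_split by blast
    show ?thesis
    proof (cases L)
      case (real r)
      then have "(h has_real_derivative r) (at x)"
        using lim unfolding has_field_derivative_iff u_def by simp
      then show ?thesis using nd real_differentiable_def by blast
    next
      case PInf
      have "\<forall>\<^sub>F y in at x. M * (y - x)\<^sup>2 \<le> 1 * (h y - h x) * (y - x)" for M
      proof -
        have "\<forall>\<^sub>F y in at x. ereal M < ereal (u y)"
          using order_tendstoD(1)[OF lim, of "ereal M"] PInf by simp
        then show ?thesis
        proof (rule eventually_mono[OF eventually_conj])
          show "\<forall>\<^sub>F y in at x. y \<noteq> x" by (rule eventually_neq_at_within)
          fix y assume y: "ereal M < ereal (u y) \<and> y \<noteq> x"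
          then have "M * (y - x)\<^sup>2 \<le> u y * (y - x)\<^sup>2" by (intro mult_right_mono) auto
          then show "M * (y - x)\<^sup>2 \<le> 1 * (h y - h x) * (y - x)"
            using ueq[of y] y by (simp add: power2_eq_square mult.assoc)
        qed
      qed
      then show ?thesis using inf[of 1] by blast
    next
      case MInf
      have "\<forall>\<^sub>F y in at x. M * (y - x)\<^sup>2 \<le> -1 * (h y - h x) * (y - x)" for M
      proof -
        have "\<forall>\<^sub>F y in at x. ereal (u y) < ereal (- M)"
          using order_tendstoD(2)[OF lim, of "ereal (- M)"] MInf by simp
        then show ?thesis
        proof (rule eventually_mono[OF eventually_conj])
          show "\<forall>\<^sub>F y in at x. y \<noteq> x" by (rule eventually_neq_at_within)
          fix y assume y: "ereal (u y) < ereal (- M) \<and> y \<noteq> x"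
          then have "M * (y - x)\<^sup>2 \<le> (- u y) * (y - x)\<^sup>2" by (intro mult_right_mono) auto
          then show "M * (y - x)\<^sup>2 \<le> -1 * (h y - h x) * (y - x)"
            using ueq[of y] y by (simp add: power2_eq_square mult.assoc)
        qed
      qed
      then show ?thesis using inf[of "-1"] by blast
    qed
  qed
qed

text \<open>Otherwise, by the dichotomy, the property holds on a whole interval. There
  \<open>s * h x - M * x\<close> is locally increasing for every \<open>M\<close>, so the increment
  of \<open>s * h\<close> over a fixed subinterval would exceed every bound.\<close>

lemma eventually_no_infinite_derivative:
  fixes s :: real
  assumes h: "definable_real_fun S h"
  shows "\<forall>\<^sub>F x in at_right 0. \<not> (\<forall>M. \<forall>\<^sub>F y in at x. M * (y - x)\<^sup>2 \<le> s * (h y - h x) * (y - x))"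
proof -
  define Q where "Q x \<longleftrightarrow> (\<forall>M. \<exists>d. 0 < d \<and> (\<forall>y. \<bar>y - x\<bar> < d \<longrightarrow>
    M * (y - x)\<^sup>2 \<le> s * (h y - h x) * (y - x)))" for x
  have Q: "(\<forall>M. \<forall>\<^sub>F y in at x. M * (y - x)\<^sup>2 \<le> s * (h y - h x) * (y - x)) \<longleftrightarrow> Q x" for x
  proof -
    \<comment> \<open>\<open>Q\<close> also admits \<open>y = x\<close>, unlike the punctured
      filter; both sides vanish there.\<close>
    have "M * (y - x)\<^sup>2 \<le> s * (h y - h x) * (y - x)" if "y = x" for y M using that by simp
    then show ?thesis
      unfolding Q_def eventually_at dist_real_def
      by (intro all_cong1 ex_cong1 conj_cong[OF refl]) blast
  qed
  have "defpred 1 (\<lambda>w. Q (w ! 0))"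
    unfolding Q_def
    by (intro defpred_intros defterm_intros defterm_fun[OF h]) (auto intro: defterm_var)
  then have "(\<forall>\<^sub>F x in at_right 0. Q x) \<or> (\<forall>\<^sub>F x in at_right 0. \<not> Q x)"
    by (intro defpred_dichotomy) auto
  moreover have "\<not> (\<forall>\<^sub>F x in at_right 0. Q x)"
  proof
    assume "\<forall>\<^sub>F x in at_right 0. Q x"
    then obtain b where b: "b > 0" "\<And>x. 0 < x \<Longrightarrow> x < b \<Longrightarrow> Q x"
      by (auto simp: eventually_at_right_field)
    define a c where "a = b / 3" and "c = 2 * b / 3"
    have ac: "0 < a" "a < c" "c < b" using b(1) by (auto simp: a_def c_def)
    \<comment> \<open>This slope makes \<open>M * (c - a)\<close> exceed the increment of
      \<open>s * h\<close> from \<open>a\<close> to \<open>c\<close> by exactly 1.\<close>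
    define M where "M = (s * (h c - h a) + 1) / (c - a)"
    have "s * h a - M * a \<le> s * h c - M * c"
    proof (rule le_of_locally_increasing[of a c "\<lambda>x. s * h x - M * x"])
      fix x assume "a \<le> x" "x \<le> c"
      then obtain d where d: "d > 0"
        "\<And>y. \<bar>y - x\<bar> < d \<Longrightarrow> M * (y - x)\<^sup>2 \<le> s * (h y - h x) * (y - x)"
        using b(2)[of x] ac unfolding Q_def by (meson le_less_trans less_le_trans)
      show "\<exists>d>0. \<forall>y. \<bar>y - x\<bar> < d \<longrightarrow> 0 \<le> (s * h y - M * y - (s * h x - M * x)) * (y - x)"
      proof (intro exI conjI allI impI)
        fix y assume "\<bar>y - x\<bar> < d"
        from d(2)[OF this] show "0 \<le> (s * h y - M * y - (s * h x - M * x)) * (y - x)"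
          by (simp add: algebra_simps power2_eq_square)
      qed (rule d(1))
    qed (use ac in simp)
    then have "M * (c - a) \<le> s * (h c - h a)" by (simp add: algebra_simps)
    moreover have "M * (c - a) = s * (h c - h a) + 1" using ac by (simp add: M_def)
    ultimately show False by simp
  qed
  ultimately show ?thesis unfolding Q by blast
qed

text \<open>By the dichotomy the alternative is that \<open>h\<close> is nowhere differentiable on
  some interval with left end 0. Close to 0 every point is then a strict local minimum of a
  rationally tilted \<open>h\<close> or \<open>-h\<close>. Such points are countable, but an
  interval is not.\<close>

lemma definable_eventually_differentiable:
  assumes h: "definable_real_fun S h"
  shows "\<forall>\<^sub>F x in at_right 0. h differentiable at x"
proof -
  have "defpred 1 (\<lambda>w. \<exists>D. \<forall>e. 0 < e \<longrightarrow> (\<exists>d. 0 < d \<and> (\<forall>y. \<bar>y - w ! 0\<bar> < d \<longrightarrow>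
      \<bar>h y - h (w ! 0) - (y - w ! 0) * D\<bar> \<le> e * \<bar>y - w ! 0\<bar>)))"
    by (intro defpred_intros defterm_intros defterm_fun[OF h]) (auto intro: defterm_var)
  then have "defpred 1 (\<lambda>w. h differentiable at (w ! 0))"
    unfolding real_differentiable_def has_real_derivative_iff_eps .
  then have "(\<forall>\<^sub>F x in at_right 0. h differentiable at x) \<or> (\<forall>\<^sub>F x in at_right 0. \<not> h differentiable at x)"
    by (intro defpred_dichotomy[of _ 0 "\<lambda>x. h differentiable at x"]) auto
  moreover have "\<not> (\<forall>\<^sub>F x in at_right 0. \<not> h differentiable at x)"
  proof
    assume "\<forall>\<^sub>F x in at_right 0. \<not> h differentiable at x"
    then have "\<forall>\<^sub>F x in at_right 0. \<exists>s\<in>{1, -1}. \<exists>q::rat.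
        \<forall>\<^sub>F y in at x. s * h x - of_rat q * x < s * h y - of_rat q * y"
      using eventually_no_infinite_derivative[OF h, of 1] eventually_no_infinite_derivative[OF h, of "-1"]
      by eventually_elim (rule nondifferentiable_imp_strict_min_tilted[OF h], auto)
    then obtain b :: real where b: "b > 0" "\<And>x. 0 < x \<Longrightarrow> x < b \<Longrightarrow> \<exists>s\<in>{1, -1}. \<exists>q::rat.
        \<forall>\<^sub>F y in at x. s * h x - of_rat q * x < s * h y - of_rat q * y"
      by (auto simp: eventually_at_right_field)
    define A where "A s = {x. \<exists>q::rat. \<exists>k::nat. \<forall>y. y \<noteq> x \<longrightarrow> \<bar>y - x\<bar> < inverse (Suc k) \<longrightarrow>
      s * h x - of_rat q * x < s * h y - of_rat q * y}" for s
    have "{0<..<b} \<subseteq> A 1 \<union> A (-1)"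
    proof
      fix x assume "x \<in> {0<..<b}"
      then obtain s and q :: rat where s: "s \<in> {1, -1}"
        and "\<forall>\<^sub>F y in at x. s * h x - of_rat q * x < s * h y - of_rat q * y"
        using b(2)[of x] unfolding greaterThanLessThan_iff by blast
      then obtain d where d: "d > 0" "\<And>y. y \<noteq> x \<Longrightarrow> \<bar>y - x\<bar> < d \<Longrightarrow>
          s * h x - of_rat q * x < s * h y - of_rat q * y"
        by (auto simp: eventually_at dist_real_def)
      obtain k where "inverse (real (Suc k)) < d"
        using reals_Archimedean[OF d(1)] by blast
      then have "x \<in> A s" unfolding A_def using d(2) by (auto intro!: exI[of _ q] exI[of _ k])
      then show "x \<in> A 1 \<union> A (-1)" using s by auto
    qed
    moreover have "countable (A s)" for s
      unfolding A_def by (rule countable_strict_local_min)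
    ultimately have "countable {0<..<b}" by (meson countable_Un countable_subset)
    then show False using uncountable_open_interval[of 0 b] b(1) by simp
  qed
  ultimately show ?thesis by blast
qed

lemma definable_deriv_funpow:
  assumes "definable_real_fun S h"
  shows "definable_real_fun S ((deriv ^^ k) h)"
  using assms by (induction k) (auto intro: definable_deriv)

end

section \<open>Smoothness and flatness at zero\<close>

fun Ck_on :: "nat \<Rightarrow> real set \<Rightarrow> (real \<Rightarrow> real) \<Rightarrow> bool" where
  "Ck_on 0 U f = continuous_on U f"
| "Ck_on (Suc n) U f = ((\<forall>t\<in>U. f differentiable (at t)) \<and> Ck_on n U (deriv f))"

lemma differentiable_deriv:
  fixes f :: "real \<Rightarrow> real"
  shows "f differentiable at t \<Longrightarrow> (f has_real_derivative deriv f t) (at t)"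
  using DERIV_deriv_iff_real_differentiable by blast

lemma Ck_on_cong:
  assumes "open U" "Ck_on n U f" "\<And>t. t \<in> U \<Longrightarrow> f t = g t"
  shows "Ck_on n U g"
  using assms(2,3)
proof (induction n arbitrary: f g)
  case 0
  then show ?case using continuous_on_cong by (metis Ck_on.simps(1))
next
  case (Suc n)
  have der: "(g has_real_derivative deriv f t) (at t)" if "t \<in> U" for t
  proof (rule has_field_derivative_transform_within_open[OF _ assms(1) that])
    show "(f has_real_derivative deriv f t) (at t)"
      using Suc.prems(1) that by (simp add: differentiable_deriv)
  qed (use Suc.prems(2) in auto)
  have "Ck_on n U (deriv g)"
  proof (rule Suc.IH)
    show "Ck_on n U (deriv f)" using Suc.prems(1) by simp
    show "deriv f t = deriv g t" if "t \<in> U" for t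
      using DERIV_imp_deriv[OF der[OF that]] by simp
  qed
  moreover have "g differentiable at t" if "t \<in> U" for t
    using der[OF that] real_differentiable_def by blast
  ultimately show ?case by simp
qed

text \<open>Lets a derivative formula known only on \<open>U\<close> stand in for
  \<open>deriv f\<close>, which need not agree with it elsewhere.\<close>

lemma Ck_on_SucI:
  assumes "open U" "\<And>t. t \<in> U \<Longrightarrow> (f has_real_derivative f' t) (at t)" "Ck_on n U f'"
  shows "Ck_on (Suc n) U f"
proof -
  have "Ck_on n U (deriv f)"
    by (rule Ck_on_cong[OF assms(1,3)]) (simp add: DERIV_imp_deriv[OF assms(2)])
  moreover have "f differentiable at t" if "t \<in> U" for t
    using assms(2)[OF that] real_differentiable_def by blast
  ultimately show ?thesis by simp
qed

lemma Ck_on_SucD: "Ck_on (Suc n) U f \<Longrightarrow> Ck_on n U f"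
proof (induction n arbitrary: f)
  case 0
  then show ?case
    by (auto intro!: continuous_at_imp_continuous_on differentiable_imp_continuous_within)
qed auto

lemma Ck_on_const: "open U \<Longrightarrow> Ck_on n U (\<lambda>x. c)"
proof (induction n arbitrary: c)
  case (Suc n)
  then show ?case by (intro Ck_on_SucI[of U _ "\<lambda>x. 0"]) auto
qed auto

lemma Ck_on_id: "open U \<Longrightarrow> Ck_on n U (\<lambda>x. x)"
proof (induction n)
  case (Suc n)
  then show ?case by (intro Ck_on_SucI[of U _ "\<lambda>x. 1"]) (auto intro: Ck_on_const)
qed auto

lemma Ck_on_add:
  assumes "open U" "Ck_on n U f" "Ck_on n U g"
  shows "Ck_on n U (\<lambda>x. f x + g x)"
  using assms(2,3)
proof (induction n arbitrary: f g)
  case (Suc n)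
  then have "Ck_on n U (\<lambda>x. deriv f x + deriv g x)" by auto
  then show ?case
    using Suc.prems
    by (intro Ck_on_SucI[OF assms(1)]) (auto intro!: derivative_eq_intros differentiable_deriv)
qed (auto intro: continuous_intros)

lemma Ck_on_mult:
  assumes "open U" "Ck_on n U f" "Ck_on n U g"
  shows "Ck_on n U (\<lambda>x. f x * g x)"
  using assms(2,3)
proof (induction n arbitrary: f g)
  case (Suc n)
  have "Ck_on n U (\<lambda>x. deriv f x * g x + deriv g x * f x)"
    using Suc Ck_on_SucD by (intro Ck_on_add[OF assms(1)]) auto
  then show ?case
  proof (rule Ck_on_SucI[OF assms(1), rotated])
    fix t assume "t \<in> U"
    then show "((\<lambda>x. f x * g x) has_real_derivative deriv f t * g t + deriv g t * f t) (at t)"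
      using Suc.prems by (intro DERIV_mult differentiable_deriv) auto
  qed
qed (auto intro: continuous_intros)

lemma Ck_on_power: "open U \<Longrightarrow> Ck_on n U f \<Longrightarrow> Ck_on n U (\<lambda>x. f x ^ k)"
  by (induction k) (auto intro: Ck_on_const Ck_on_mult)

lemma Ck_on_compose:
  assumes "open U" "Ck_on n V f" "Ck_on n U s" "s ` U \<subseteq> V"
  shows "Ck_on n U (\<lambda>x. f (s x))"
  using assms(2,3)
proof (induction n arbitrary: f)
  case 0
  then show ?case using assms(4) by (auto intro: continuous_on_compose2)
next
  case (Suc n)
  have "Ck_on n U (\<lambda>x. deriv f (s x) * deriv s x)"
    using Suc Ck_on_SucD by (intro Ck_on_mult[OF assms(1)]) auto
  then show ?case
  proof (rule Ck_on_SucI[OF assms(1), rotated])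
    fix t assume "t \<in> U"
    then show "((\<lambda>x. f (s x)) has_real_derivative deriv f (s t) * deriv s t) (at t)"
      using Suc.prems assms(4) by (intro DERIV_chain2[of f] differentiable_deriv) auto
  qed
qed

lemma Ck_on_inverse_one_plus: "Ck_on n {0<..} (\<lambda>u. inverse (1 + u))"
proof (induction n)
  case 0
  then show ?case by (auto intro!: continuous_intros)
next
  case (Suc n)
  then have "Ck_on n {0<..} (\<lambda>u. (-1) * (inverse (1 + u) * inverse (1 + u)))"
    by (intro Ck_on_mult Ck_on_const) auto
  then show ?case
    by (intro Ck_on_SucI[of _ _ "\<lambda>u. (-1) * (inverse (1 + u) * inverse (1 + u))"])
      (auto intro!: derivative_eq_intros)
qed

text \<open>Away from 0 the derivative of the absolute value is the sign, which is locally
  constant.\<close>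

lemma Ck_on_abs: "Ck_on n (- {0}) abs"
proof (cases n)
  case 0
  then show ?thesis by (auto intro!: continuous_intros)
next
  case (Suc k)
  have "Ck_on k (- {0}) sgn"
  proof (cases k)
    case 0
    have "continuous_on (- {0}) (sgn :: real \<Rightarrow> real)"
      by (intro continuous_on_sgn continuous_on_id) auto
    with 0 show ?thesis by simp
  next
    case (Suc j)
    have "(sgn has_real_derivative 0) (at t)" if "t \<noteq> 0" for t :: real
      using has_field_derivative_transform_within_open[OF DERIV_const, of "{0<..}" t "sgn t" sgn]
        has_field_derivative_transform_within_open[OF DERIV_const, of "{..<0}" t "sgn t" sgn] that
      by (cases "t > 0") auto
    then show ?thesis
      unfolding Suc by (intro Ck_on_SucI[of _ _ "\<lambda>x. 0"] Ck_on_const) auto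
  qed
  moreover have "(abs has_real_derivative sgn t) (at t)" if "t \<noteq> 0" for t :: real
  proof (cases "t > 0")
    case True
    then show ?thesis
      using has_field_derivative_transform_within_open[OF DERIV_ident, of "{0<..}" t abs] by simp
  next
    case False
    then show ?thesis
      using has_field_derivative_transform_within_open[OF DERIV_minus[OF DERIV_ident], of "{..<0}" t abs]
        that by simp
  qed
  ultimately show ?thesis unfolding Suc by (intro Ck_on_SucI[of _ _ sgn]) auto
qed

text \<open>The hypothesis includes order \<open>n\<close> itself: differentiability of the last
  derivative supplies its continuity.\<close>

lemma Ck_on_funpow_deriv:
  assumes "\<And>k t. k \<le> n \<Longrightarrow> t \<in> U \<Longrightarrow> (deriv ^^ k) h differentiable at t"
  shows "Ck_on n U h"
  using assms
proof (induction n arbitrary: h)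
  case 0
  then show ?case
    by (auto intro!: continuous_at_imp_continuous_on differentiable_imp_continuous_within
        simp: Ball_def dest: spec)
next
  case (Suc n)
  have "Ck_on n U (deriv h)"
    using Suc.prems[of "Suc _"] by (intro Suc.IH) (simp add: funpow_swap1)
  then show ?case using Suc.prems[of 0] by simp
qed

section \<open>Little-o bounds at zero\<close>

definition small_o :: "nat \<Rightarrow> (real \<Rightarrow> real) \<Rightarrow> bool" where
  "small_o n \<psi> \<longleftrightarrow> (\<forall>q>0. \<exists>d>0. \<forall>t. \<bar>t\<bar> < d \<longrightarrow> \<bar>\<psi> t\<bar> \<le> q * \<bar>t\<bar> ^ n)"

text \<open>The bound in \<open>small_o\<close> includes \<open>t = 0\<close>, so it forces the
  value 0 even for \<open>n = 0\<close>, where \<open>0 ^ 0 = 1\<close> and only letting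
  \<open>q\<close> shrink helps.\<close>

lemma small_o_zero:
  assumes "small_o n \<psi>"
  shows "\<psi> 0 = 0"
proof -
  have "\<bar>\<psi> 0\<bar> \<le> q" if q: "q > 0" for q
  proof -
    obtain d where "d > 0" "\<And>t. \<bar>t\<bar> < d \<Longrightarrow> \<bar>\<psi> t\<bar> \<le> q * \<bar>t\<bar> ^ n"
      using assms q unfolding small_o_def by blast
    then have "\<bar>\<psi> 0\<bar> \<le> q * \<bar>0\<bar> ^ n" by (metis abs_zero)
    also have "\<dots> \<le> q" using q by (cases n) auto
    finally show ?thesis .
  qed
  then show ?thesis using field_le_epsilon[of "\<bar>\<psi> 0\<bar>" 0] by simp
qed

lemma small_o_Suc_derivative:
  assumes "small_o (Suc n) \<psi>"
  shows "(\<psi> has_real_derivative 0) (at 0)"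
  unfolding has_real_derivative_iff_eps
proof (intro allI impI)
  fix e :: real assume "e > 0"
  then obtain d where d: "d > 0" "\<And>t. \<bar>t\<bar> < d \<Longrightarrow> \<bar>\<psi> t\<bar> \<le> e * \<bar>t\<bar> ^ Suc n"
    using assms unfolding small_o_def by blast
  show "\<exists>d>0. \<forall>y. \<bar>y - 0\<bar> < d \<longrightarrow> \<bar>\<psi> y - \<psi> 0 - (y - 0) * 0\<bar> \<le> e * \<bar>y - 0\<bar>"
  \<comment> \<open>A radius of at most 1 bounds the higher power of \<open>\<bar>y\<bar>\<close> by
    \<open>\<bar>y\<bar>\<close> itself.\<close>
  proof (intro exI[of _ "min d 1"] conjI allI impI)
    fix y assume y: "\<bar>y - 0\<bar> < min d 1"
    then have "\<bar>y\<bar> ^ Suc n \<le> \<bar>y\<bar> * 1"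
      unfolding power_Suc by (intro mult_left_mono power_le_one) auto
    then have "e * \<bar>y\<bar> ^ Suc n \<le> e * \<bar>y\<bar>" using \<open>e > 0\<close> by simp
    then show "\<bar>\<psi> y - \<psi> 0 - (y - 0) * 0\<bar> \<le> e * \<bar>y - 0\<bar>"
      using d(2)[of y] y small_o_zero[OF assms] by simp
  qed (use d in auto)
qed

context ominimal
begin

text \<open>Each derivative up to order \<open>n\<close> is definable, hence differentiable near 0
  on the right, and finitely many such neighbourhoods have a common one.\<close>

lemma definable_eventually_Ck:
  assumes "definable_real_fun S h"
  obtains c where "0 < c" "c \<le> 1" "Ck_on n {0<..<c} h"
proof -
  have "\<forall>\<^sub>F x in at_right 0. \<forall>k\<in>{..n}. (deriv ^^ k) h differentiable at x"
    using assms by (intro eventually_ball_finite ballI definable_eventually_differentiable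
        definable_deriv_funpow) auto
  then obtain b where b: "b > 0"
    "\<And>x k. 0 < x \<Longrightarrow> x < b \<Longrightarrow> k \<le> n \<Longrightarrow> (deriv ^^ k) h differentiable at x"
    by (auto simp: eventually_at_right_field)
  have "Ck_on n {0<..<min b 1} h"
    using b(2) by (intro Ck_on_funpow_deriv) auto
  with b(1) show ?thesis by (intro that[of "min b 1"]) auto
qed

text \<open>Otherwise the dichotomy gives \<open>deriv \<psi> t > q * t ^ n\<close> on an interval
  with left end 0. Integrating this lower bound from \<open>s\<close> to \<open>t\<close> makes
  \<open>\<psi>\<close> grow faster than its smallness allows.\<close>

lemma eventually_deriv_le:
  assumes \<psi>: "definable_real_fun S \<psi>" and q: "q > 0"
    and diff: "\<And>t. t > 0 \<Longrightarrow> \<psi> differentiable at t"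
    and small: "\<And>q. q > 0 \<Longrightarrow> \<forall>\<^sub>F t in at_right 0. \<bar>\<psi> t\<bar> \<le> q * t ^ Suc n"
  shows "\<forall>\<^sub>F t in at_right 0. deriv \<psi> t \<le> q * t ^ n"
proof (rule ccontr)
  assume neg: "\<not> ?thesis"
  have "defpred 1 (\<lambda>w. deriv \<psi> (w ! 0) \<le> q * (w ! 0) ^ n)"
    by (intro defpred_intros defterm_intros defterm_fun[OF definable_deriv[OF \<psi>]]) (auto intro: defterm_var)
  then have ev: "\<forall>\<^sub>F t in at_right 0. \<not> deriv \<psi> t \<le> q * t ^ n"
    using neg defpred_dichotomy[of "at_right 0" 0 "\<lambda>t. deriv \<psi> t \<le> q * t ^ n"] by blast
  \<comment> \<open>With this \<open>A\<close>, the function \<open>A * x ^ Suc n\<close> is a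
    primitive of \<open>q * x ^ n\<close>.\<close>
  define A where "A = q / real (Suc n)"
  have A: "A > 0" using q by (simp add: A_def)
  then have "\<forall>\<^sub>F t in at_right 0. \<bar>\<psi> t\<bar> \<le> A / 2 * t ^ Suc n"
    by (intro small) simp
  with ev have "\<forall>\<^sub>F t in at_right 0. q * t ^ n < deriv \<psi> t \<and> \<bar>\<psi> t\<bar> \<le> A / 2 * t ^ Suc n"
    by eventually_elim simp
  then obtain b where b: "b > 0" "\<And>t. 0 < t \<Longrightarrow> t < b \<Longrightarrow> q * t ^ n < deriv \<psi> t"
      "\<And>t. 0 < t \<Longrightarrow> t < b \<Longrightarrow> \<bar>\<psi> t\<bar> \<le> A / 2 * t ^ Suc n"
    by (auto simp: eventually_at_right_field)
  \<comment> \<open>Monotonicity and the two bounds on \<open>\<psi>\<close> will give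
    \<open>A * t ^ Suc n \<le> 3 * (A * s ^ Suc n)\<close>. A ratio of \<open>s\<close> to
    \<open>t\<close> below one third contradicts this for every \<open>n\<close>.\<close>
  define t s where "t = b / 2" and "s = t / 4"
  have ts: "0 < s" "s < t" "t < b" using b(1) by (auto simp: t_def s_def)
  have "\<psi> s - A * s ^ Suc n \<le> \<psi> t - A * t ^ Suc n"
  proof (rule DERIV_nonneg_imp_nondecreasing[of s t "\<lambda>x. \<psi> x - A * x ^ Suc n"])
    fix x assume x: "s \<le> x" "x \<le> t"
    have "((\<lambda>x. \<psi> x - A * x ^ Suc n) has_real_derivative deriv \<psi> x - q * x ^ n) (at x)"
      using x ts diff[of x] unfolding A_def
      by (auto intro!: derivative_eq_intros differentiable_deriv simp del: power_Suc)
    then show "\<exists>y. ((\<lambda>x. \<psi> x - A * x ^ Suc n) has_real_derivative y) (at x) \<and> 0 \<le> y"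
      using b(2)[of x] x ts by (intro exI[of _ "deriv \<psi> x - q * x ^ n"]) auto
  qed (use ts in simp)
  moreover have "\<bar>\<psi> s\<bar> \<le> A / 2 * s ^ Suc n" "\<bar>\<psi> t\<bar> \<le> A / 2 * t ^ Suc n"
    using b(3) ts by auto
  ultimately have "A * t ^ Suc n \<le> 3 * (A * s ^ Suc n)" by linarith
  moreover have "s ^ Suc n \<le> t / 4 * t ^ n"
    unfolding power_Suc using ts by (intro mult_mono power_mono) (auto simp: s_def)
  ultimately have "A * t ^ Suc n \<le> 3 * (A * (t / 4 * t ^ n))"
    using A by (meson less_imp_le mult_left_mono order_trans zero_le_numeral)
  moreover have "A * t ^ Suc n > 0" using A ts by simp
  ultimately show False by simp
qed

text \<open>Little-o bounds cannot be differentiated in general; here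
  \<open>eventually_deriv_le\<close> allows it. That lemma bounds a derivative from above on the
  right of 0, so it is applied to four reflections of \<open>\<psi>\<close>.\<close>

lemma small_o_deriv:
  assumes \<psi>: "definable_real_fun S \<psi>"
    and diff: "\<And>t. t \<noteq> 0 \<Longrightarrow> \<psi> differentiable at t"
    and small: "small_o (Suc n) \<psi>"
  shows "small_o n (deriv \<psi>)"
proof -
  have zero: "deriv \<psi> 0 = 0"
    using small_o_Suc_derivative[OF small] DERIV_imp_deriv by blast
  have ev: "\<forall>\<^sub>F t in at_right 0. s * (r * deriv \<psi> (r * t)) \<le> q * t ^ n"
    if sr: "s \<in> {1, -1}" "r \<in> {1, -1}" and q: "q > 0" for s r q :: real
  proof -
    \<comment> \<open>The sign \<open>s\<close> reflects the values and \<open>r\<close> the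
      argument; the four choices give upper and lower bounds on both sides of 0.\<close>
    define \<rho> where "\<rho> t = s * \<psi> (r * t)" for t
    have der: "(\<rho> has_real_derivative s * (r * deriv \<psi> (r * t))) (at t)" if "t > 0" for t
    proof -
      have "((\<lambda>t. \<psi> (r * t)) has_real_derivative deriv \<psi> (r * t) * r) (at t)"
        using sr(2) that by (intro DERIV_chain2[OF differentiable_deriv[OF diff]])
          (auto intro!: derivative_eq_intros)
      from DERIV_cmult[OF this, of s] show ?thesis
        unfolding \<rho>_def by (simp only: mult.commute[of _ r])
    qed
    have "\<forall>\<^sub>F t in at_right 0. deriv \<rho> t \<le> q * t ^ n"
    proof (rule eventually_deriv_le[OF _ q])
      show "definable_real_fun S \<rho>"
        unfolding \<rho>_def
        by (rule definable_real_funI, intro defterm_intros defterm_fun[OF \<psi>]) (auto intro: defterm_var)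
      show "\<rho> differentiable at t" if "t > 0" for t
        using der[OF that] real_differentiable_def by blast
      fix q :: real assume "q > 0"
      then obtain d where d: "d > 0" "\<And>t. \<bar>t\<bar> < d \<Longrightarrow> \<bar>\<psi> t\<bar> \<le> q * \<bar>t\<bar> ^ Suc n"
        using small unfolding small_o_def by blast
      show "\<forall>\<^sub>F t in at_right 0. \<bar>\<rho> t\<bar> \<le> q * t ^ Suc n"
      proof (rule eventually_at_rightI[OF _ d(1)])
        fix t assume t: "t \<in> {0<..<d}"
        have "\<bar>r * t\<bar> = t" using sr(2) t by auto
        moreover from this have "\<bar>\<psi> (r * t)\<bar> \<le> q * \<bar>r * t\<bar> ^ Suc n" using t by (intro d(2)) auto
        ultimately show "\<bar>\<rho> t\<bar> \<le> q * t ^ Suc n" using sr(1) by (auto simp: \<rho>_def)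
      qed
    qed
    moreover have "\<forall>\<^sub>F t in at_right 0. (0::real) < t" by (rule eventually_at_right_less)
    ultimately show ?thesis
    proof eventually_elim
      case (elim t)
      then show ?case using DERIV_imp_deriv[OF der] by simp
    qed
  qed
  show ?thesis unfolding small_o_def
  proof (intro allI impI)
    fix q :: real assume q: "q > 0"
    have "\<forall>\<^sub>F t in at_right 0. deriv \<psi> t \<le> q * t ^ n \<and> - deriv \<psi> t \<le> q * t ^ n \<and>
        deriv \<psi> (- t) \<le> q * t ^ n \<and> - deriv \<psi> (- t) \<le> q * t ^ n"
      using ev[of 1 1, OF _ _ q] ev[of "-1" 1, OF _ _ q] ev[of 1 "-1", OF _ _ q] ev[of "-1" "-1", OF _ _ q]
      by (simp add: eventually_conj_iff)
    then obtain d where d: "d > 0" "\<And>t. 0 < t \<Longrightarrow> t < d \<Longrightarrow> \<bar>deriv \<psi> t\<bar> \<le> q * t ^ n"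
      "\<And>t. 0 < t \<Longrightarrow> t < d \<Longrightarrow> \<bar>deriv \<psi> (- t)\<bar> \<le> q * t ^ n"
      unfolding eventually_at_right_field by (fastforce simp: abs_le_iff)
    have "\<bar>deriv \<psi> t\<bar> \<le> q * \<bar>t\<bar> ^ n" if "\<bar>t\<bar> < d" for t
    proof -
      consider "t = 0" | "t > 0" | "t < 0" by linarith
      then show ?thesis
        by cases (use zero q d(2)[of t] d(3)[of "- t"] that in auto)
    qed
    with d(1) show "\<exists>d>0. \<forall>t. \<bar>t\<bar> < d \<longrightarrow> \<bar>deriv \<psi> t\<bar> \<le> q * \<bar>t\<bar> ^ n" by blast
  qed
qed

text \<open>Induction on \<open>n\<close>: smallness of order \<open>n + 1\<close> gives derivative
  0 at the origin, and \<open>deriv \<psi>\<close> again satisfies all three hypotheses with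
  \<open>n\<close>, by \<open>small_o_deriv\<close> for the last one.\<close>

lemma Ck_flat_of_small_o:
  assumes "definable_real_fun S \<psi>" "Ck_on n (- {0}) \<psi>" "small_o n \<psi>"
  shows "Ck n \<psi> \<and> p_flat_at_zero n \<psi>"
  using assms
proof (induction n arbitrary: \<psi>)
  case 0
  have "isCont \<psi> t" for t
  proof (cases "t = 0")
    case True
    have "\<exists>d>0. \<forall>y. dist y 0 < d \<longrightarrow> dist (\<psi> y) (\<psi> 0) < e" if "e > 0" for e
    proof -
      have "e / 2 > 0" using that by simp
      then obtain d where "d > 0" "\<And>t. \<bar>t\<bar> < d \<Longrightarrow> \<bar>\<psi> t\<bar> \<le> e / 2 * \<bar>t\<bar> ^ 0"
        using 0(3) unfolding small_o_def by blast
      then show ?thesis using small_o_zero[OF 0(3)] that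
        by (intro exI[of _ d]) (fastforce simp: dist_real_def)
    qed
    then show ?thesis unfolding True continuous_at_eps_delta by blast
  next
    case False
    then show ?thesis using 0(2) continuous_on_eq_continuous_at[of "- {0}" \<psi>] by auto
  qed
  then show ?case
    using small_o_zero[OF 0(3)] by (auto simp: p_flat_at_zero_def continuous_at_imp_continuous_on)
next
  case (Suc n)
  have zero: "(\<psi> has_real_derivative 0) (at 0)"
    by (rule small_o_Suc_derivative[OF Suc.prems(3)])
  then have diff: "\<psi> differentiable at t" for t
    using Suc.prems(2) real_differentiable_def by (cases "t = 0") auto
  have IH: "Ck n (deriv \<psi>) \<and> p_flat_at_zero n (deriv \<psi>)"
    using Suc.prems diff
    by (intro Suc.IH small_o_deriv definable_deriv) auto
  have "(deriv ^^ k) \<psi> 0 = 0" if "k \<le> Suc n" for k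
  proof (cases k)
    case 0
    then show ?thesis using small_o_zero[OF Suc.prems(3)] by simp
  next
    case (Suc j)
    then show ?thesis using IH that by (simp add: p_flat_at_zero_def funpow_swap1)
  qed
  then show ?case using IH diff by (simp add: p_flat_at_zero_def)
qed

end

section \<open>Separation from the generalised zero set\<close>

lemma sum_lessThan_add:
  fixes F :: "nat \<Rightarrow> 'a::comm_monoid_add"
  shows "(\<Sum>i<m + n. F i) = (\<Sum>i<m. F i) + (\<Sum>j<n. F (m + j))"
  by (induction n) (auto simp: add.assoc)

lemma ldist_append_zeros:
  assumes "length z = m" "length x = m" "length y = n"
  shows "ldist (z @ replicate n 0) (x @ y) = sqrt ((ldist z x)\<^sup>2 + (lnorm y)\<^sup>2)"
  using assms
  by (simp add: ldist_def lnorm_def sum_lessThan_add nth_append sum_nonneg)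

lemma ldist_nonneg: "0 \<le> ldist x y"
  by (simp add: ldist_def sum_nonneg)

lemma lnorm_nonneg: "0 \<le> lnorm x"
  by (simp add: lnorm_def sum_nonneg)

lemma ldist_commute: "length x = length y \<Longrightarrow> ldist x y = ldist y x"
  by (simp add: ldist_def power2_commute)

lemma nth_diff_le_ldist:
  assumes "i < length x"
  shows "\<bar>x ! i - y ! i\<bar> \<le> ldist x y"
proof -
  have "(x ! i - y ! i)\<^sup>2 \<le> (\<Sum>i<length x. (x ! i - y ! i)\<^sup>2)"
    using assms by (intro member_le_sum) auto
  then show ?thesis unfolding ldist_def by (simp add: real_le_rsqrt)
qed

text \<open>Bolzano-Weierstrass, one coordinate at a time: each step refines the subsequence found
  for the earlier coordinates.\<close>

lemma bounded_lists_convergent_subseq: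
  fixes X :: "nat \<Rightarrow> real list"
  assumes "\<And>i. i < m \<Longrightarrow> bounded (range (\<lambda>k. X k ! i))"
  obtains r l where "strict_mono (r :: nat \<Rightarrow> nat)" "\<And>i. i < m \<Longrightarrow> (\<lambda>k. X (r k) ! i) \<longlonglongrightarrow> l i"
proof -
  have "\<exists>r l. strict_mono (r :: nat \<Rightarrow> nat) \<and> (\<forall>i<m. (\<lambda>k. X (r k) ! i) \<longlonglongrightarrow> l i)"
    using assms
  proof (induction m)
    case 0
    then show ?case by (auto intro: strict_mono_id)
  next
    case (Suc m)
    then obtain r l where r: "strict_mono (r :: nat \<Rightarrow> nat)"
      "\<And>i. i < m \<Longrightarrow> (\<lambda>k. X (r k) ! i) \<longlonglongrightarrow> l i" by fastforce
    have "bounded (range (\<lambda>k. X (r k) ! m))"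
      using Suc.prems[of m] by (rule bounded_subset) auto
    then obtain b r' where r': "strict_mono (r' :: nat \<Rightarrow> nat)" "((\<lambda>k. X (r k) ! m) \<circ> r') \<longlonglongrightarrow> b"
      using bounded_imp_convergent_subsequence by blast
    have "(\<lambda>k. X ((r \<circ> r') k) ! i) \<longlonglongrightarrow> (l(m := b)) i" if "i < Suc m" for i
    proof (cases "i = m")
      case False
      then show ?thesis using LIMSEQ_subseq_LIMSEQ[OF r(2) r'(1), of i] that by (simp add: comp_def)
    qed (use r'(2) in \<open>simp add: comp_def\<close>)
    then show ?case using strict_mono_o[OF r(1) r'(1)] by blast
  qed
  then show ?thesis using that by blast
qed

text \<open>The inserted 1 keeps the set nonempty, so that its infimum is meaningful, and caps that
  infimum. The bound on all distances to the zero set replaces a condition on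
  \<open>lsetdist\<close>, which avoids a second infimum in the definability proof.\<close>

definition separated_values ::
  "nat \<Rightarrow> nat \<Rightarrow> real list set \<Rightarrow> (real list \<Rightarrow> real list) \<Rightarrow> real list \<Rightarrow> real \<Rightarrow> real set" where
  "separated_values m n \<Omega> f a t = insert 1 {lnorm (f x) | x. x \<in> \<Omega> \<and> ldist x a \<le> 1 \<and>
     (\<forall>z\<in>gen_zero_set m n \<Omega> f. t \<le> ldist x z)}"

definition separation ::
  "nat \<Rightarrow> nat \<Rightarrow> real list set \<Rightarrow> (real list \<Rightarrow> real list) \<Rightarrow> real list \<Rightarrow> real \<Rightarrow> real" where
  "separation m n \<Omega> f a t = Inf (separated_values m n \<Omega> f a t)"

lemma bdd_below_separated_values: "bdd_below (separated_values m n \<Omega> f a t)"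
  unfolding separated_values_def by (rule bdd_belowI[of _ 0]) (auto simp: lnorm_nonneg)

lemma separation_mono:
  assumes "s \<le> t"
  shows "separation m n \<Omega> f a s \<le> separation m n \<Omega> f a t"
  unfolding separation_def
proof (rule cInf_superset_mono)
  show "separated_values m n \<Omega> f a t \<subseteq> separated_values m n \<Omega> f a s"
    using assms unfolding separated_values_def by fastforce
qed (simp add: separated_values_def, rule bdd_below_separated_values)

lemma separation_le_1: "separation m n \<Omega> f a t \<le> 1"
  unfolding separation_def
  by (rule cInf_lower[OF _ bdd_below_separated_values]) (simp add: separated_values_def)

lemma separation_le:
  assumes "x \<in> \<Omega>" "ldist x a \<le> 1" "\<And>z. z \<in> gen_zero_set m n \<Omega> f \<Longrightarrow> t \<le> ldist x z"
  shows "separation m n \<Omega> f a t \<le> lnorm (f x)"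
  unfolding separation_def
  by (rule cInf_lower[OF _ bdd_below_separated_values]) (use assms in \<open>auto simp: separated_values_def\<close>)

text \<open>Otherwise there are points of the unit ball around \<open>a\<close>, at distance at
  least \<open>t\<close> from the zero set, at which \<open>f\<close> tends to 0. A subsequence
  converges to some \<open>z\<close>, and \<open>z\<close> padded with zeros lies in the closure of
  the graph. So \<open>z\<close> is in the zero set, yet the points come arbitrarily close to
  it.\<close>

lemma separation_pos:
  assumes \<Omega>: "\<Omega> \<subseteq> Rn m" and f: "\<And>x. x \<in> \<Omega> \<Longrightarrow> length (f x) = n"
    and "t > 0"
  shows "0 < separation m n \<Omega> f a t"
proof (rule ccontr)
  let ?Z = "gen_zero_set m n \<Omega> f"
  assume "\<not> ?thesis"
  then have "separation m n \<Omega> f a t < inverse (real (Suc k))" for k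
    by (smt (verit) inverse_positive_iff_positive of_nat_0_less_iff zero_less_Suc)
  then have "\<exists>v\<in>separated_values m n \<Omega> f a t. v < inverse (real (Suc k))" for k
    unfolding separation_def
    by (rule cInf_lessD[rotated]) (simp add: separated_values_def)
  \<comment> \<open>This excludes the inserted value 1, so the small value is attained at a point of
    \<open>\<Omega>\<close>.\<close>
  moreover have "inverse (real (Suc k)) \<le> 1" for k by (simp add: field_simps)
  ultimately have "\<exists>x. x \<in> \<Omega> \<and> ldist x a \<le> 1 \<and> (\<forall>z\<in>?Z. t \<le> ldist x z) \<and>
      lnorm (f x) < inverse (real (Suc k))" for k
    unfolding separated_values_def by (smt (verit) insertE mem_Collect_eq)
  then obtain X where X: "\<And>k. X k \<in> \<Omega>" "\<And>k. ldist (X k) a \<le> 1"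
    "\<And>k z. z \<in> ?Z \<Longrightarrow> t \<le> ldist (X k) z" "\<And>k. lnorm (f (X k)) < inverse (real (Suc k))"
    by metis
  have lenX: "length (X k) = m" for k using X(1) \<Omega> by (auto simp: Rn_def)
  have "bounded (range (\<lambda>k. X k ! i))" if "i < m" for i
    unfolding bounded_def
  proof (intro exI ballI)
    fix y assume "y \<in> range (\<lambda>k. X k ! i)"
    then obtain k where "y = X k ! i" by blast
    then show "dist (a ! i) y \<le> 1"
      using nth_diff_le_ldist[of i "X k" a] X(2)[of k] that lenX by (simp add: dist_real_def)
  qed
  then obtain r l where r: "strict_mono (r :: nat \<Rightarrow> nat)"
    and l: "\<And>i. i < m \<Longrightarrow> (\<lambda>k. X (r k) ! i) \<longlonglongrightarrow> l i"
    using bounded_lists_convergent_subseq[of m X] by blast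
  define z where "z = map l [0..<m]"
  have lenz: "length z = m" by (simp add: z_def)
  have "(\<lambda>k. sqrt (\<Sum>i<m. (X (r k) ! i - z ! i)\<^sup>2)) \<longlonglongrightarrow> sqrt (\<Sum>i<m. (l i - z ! i)\<^sup>2)"
    by (intro tendsto_intros l) auto
  then have d0: "(\<lambda>k. ldist (X (r k)) z) \<longlonglongrightarrow> 0"
    by (simp add: ldist_def lenX z_def)
  have "(\<lambda>k. lnorm (f (X k))) \<longlonglongrightarrow> 0"
  proof (rule tendsto_sandwich[OF _ _ tendsto_const LIMSEQ_inverse_real_of_nat])
    show "\<forall>\<^sub>F k in sequentially. lnorm (f (X k)) \<le> inverse (real (Suc k))"
      by (rule always_eventually) (use X(4) less_imp_le in blast)
  qed (simp add: lnorm_nonneg)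
  then have "(\<lambda>k. lnorm (f (X (r k)))) \<longlonglongrightarrow> 0"
    using LIMSEQ_subseq_LIMSEQ[OF _ r] by (auto simp: comp_def)
  then have "(\<lambda>k. sqrt ((ldist (X (r k)) z)\<^sup>2 + (lnorm (f (X (r k))))\<^sup>2)) \<longlonglongrightarrow> sqrt (0\<^sup>2 + 0\<^sup>2)"
    by (intro tendsto_intros d0)
  moreover have "sqrt ((ldist (X (r k)) z)\<^sup>2 + (lnorm (f (X (r k))))\<^sup>2) =
      ldist (z @ replicate n 0) (X (r k) @ f (X (r k)))" for k
    using f[OF X(1)] lenX lenz by (simp add: ldist_append_zeros ldist_commute)
  ultimately have g0: "(\<lambda>k. ldist (z @ replicate n 0) (X (r k) @ f (X (r k)))) \<longlonglongrightarrow> 0"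
    by simp
  have "z \<in> ?Z"
    unfolding gen_zero_set_def lclosure_def
  proof (intro CollectI conjI allI impI)
    fix e :: real assume "e > 0"
    then obtain k where "ldist (z @ replicate n 0) (X (r k) @ f (X (r k))) < e"
      using order_tendstoD(2)[OF g0] eventually_happens' sequentially_bot by blast
    then show "\<exists>g\<in>lgraph \<Omega> f. ldist (z @ replicate n 0) g < e"
      using X(1) unfolding lgraph_def by blast
  qed (use lenz in \<open>auto simp: Rn_def\<close>)
  then have "t \<le> ldist (X (r k)) z" for k using X(3) by blast
  then have "t \<le> 0" using d0 by (intro LIMSEQ_le_const[OF d0]) auto
  then show False using \<open>t > 0\<close> by simp
qed

section \<open>Definability of the separation function\<close>

context ominimal
begin

lemma defterm_sqrt:
  assumes "defterm k T"
  shows "defterm k (\<lambda>x. sqrt (T x))"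
proof (rule defterm_op1[OF _ assms])
  \<comment> \<open>\<open>sqrt\<close> is total and odd in HOL, so negative arguments need a branch
    of their own.\<close>
  have "defpred 2 (\<lambda>y. (0 \<le> y ! 0 \<and> 0 \<le> y ! 1 \<and> (y ! 1)\<^sup>2 = y ! 0) \<or>
      (y ! 0 < 0 \<and> y ! 1 \<le> 0 \<and> (y ! 1)\<^sup>2 = - y ! 0))"
    by (intro defpred_intros defterm_intros defterm_var) auto
  moreover have "(0 \<le> x \<and> 0 \<le> y \<and> y\<^sup>2 = x) \<or> (x < 0 \<and> y \<le> 0 \<and> y\<^sup>2 = - x) \<longleftrightarrow> y = sqrt x" for x y :: real
  proof (cases "0 \<le> x")
    case True
    then show ?thesis by (auto simp: real_sqrt_unique)
  next
    case False
    then have "y = sqrt x \<longleftrightarrow> sqrt (- x) = - y" by (auto simp: real_sqrt_minus)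
    also have "\<dots> \<longleftrightarrow> y \<le> 0 \<and> y\<^sup>2 = - x"
      using False real_sqrt_unique[of "- y" "- x"] by (auto simp: real_sqrt_minus power2_eq_square)
    finally show ?thesis using False by auto
  qed
  ultimately show "defpred 2 (\<lambda>y. y ! 1 = sqrt (y ! 0))" by simp
qed

text \<open>\<open>defpred_ex_vec\<close> presents its bound vector as \<open>drop k w\<close>. This
  lemma reads off its entries, and the next one does so below a further quantifier, which adds a
  \<open>take\<close>.\<close>

lemma defterm_nth_drop: "j + i < k \<Longrightarrow> defterm k (\<lambda>w. drop j w ! i)"
  unfolding defterm_def
  by (rule iffD1[OF defpred_cong defpred_eq[OF defterm_var defterm_var]]) (auto simp: min_def)

lemma defterm_nth_drop_take: "j + i < l \<Longrightarrow> j + i < k \<Longrightarrow> defterm k (\<lambda>w. drop j (take l w) ! i)"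
  unfolding defterm_def
  by (rule iffD1[OF defpred_cong defpred_eq[OF defterm_var[of k] defterm_var[of "j + i"]]]) auto

text \<open>Membership in the closure is a first-order statement about the graph. Splitting the
  distance into the first \<open>m\<close> and the last \<open>n\<close> coordinates removes the
  padding zeros from the formula.\<close>

lemma definable_gen_zero_set:
  assumes f: "definable_fun S m n \<Omega> f"
  shows "gen_zero_set m n \<Omega> f \<in> S m"
proof -
  define G where "G = lgraph \<Omega> f"
  have G: "G \<in> S (m + n)" using f by (simp add: G_def definable_fun_def)
  have "defpred m (\<lambda>z. \<forall>e. 0 < e \<longrightarrow> (\<exists>g. length g = m + n \<and> (g \<in> G \<and>
      sqrt ((\<Sum>i<m. (z ! i - g ! i)\<^sup>2) + (\<Sum>j<n. (g ! (m + j))\<^sup>2)) < e)))"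
    by (intro defpred_intros defpred_ex_vec defpred_drop_mem[OF G] defterm_intros defterm_sqrt)
      (auto intro!: defterm_var defterm_nth_drop)
  then have "defpred m (\<lambda>z. z \<in> gen_zero_set m n \<Omega> f)"
  proof (rule iffD1[OF defpred_cong, rotated])
    fix z :: "real list" assume z: "length z = m"
    have len: "length g = m + n" if "g \<in> G" for g
      using S_subset[OF G] that by (auto simp: Rn_def)
    have "(\<exists>g. length g = m + n \<and> (g \<in> G \<and> P g)) \<longleftrightarrow> (\<exists>g\<in>G. P g)" for P
      using len by blast
    moreover have "ldist (z @ replicate n 0) g =
        sqrt ((\<Sum>i<m. (z ! i - g ! i)\<^sup>2) + (\<Sum>j<n. (g ! (m + j))\<^sup>2))" for g
      using z by (simp add: ldist_def sum_lessThan_add nth_append)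
    ultimately show "(\<forall>e. 0 < e \<longrightarrow> (\<exists>g. length g = m + n \<and> (g \<in> G \<and>
        sqrt ((\<Sum>i<m. (z ! i - g ! i)\<^sup>2) + (\<Sum>j<n. (g ! (m + j))\<^sup>2)) < e))) \<longleftrightarrow>
        z \<in> gen_zero_set m n \<Omega> f"
      using z unfolding gen_zero_set_def lclosure_def Rn_def G_def[symmetric] by simp
  qed
  moreover have "{z \<in> Rn m. z \<in> gen_zero_set m n \<Omega> f} = gen_zero_set m n \<Omega> f"
    by (auto simp: gen_zero_set_def)
  ultimately show ?thesis by (simp add: defpred_def)
qed

lemma definable_separation:
  assumes f: "definable_fun S m n \<Omega> f"
  shows "definable_real_fun S (separation m n \<Omega> f a)"
proof -
  define G where "G = lgraph \<Omega> f"
  define Z where "Z = gen_zero_set m n \<Omega> f"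
  have G: "G \<in> S (m + n)" using f by (simp add: G_def definable_fun_def)
  have Z: "Z \<in> S m" using definable_gen_zero_set[OF f] by (simp add: Z_def)
  \<comment> \<open>The quantified vector is a graph point \<open>q\<close>: its first
    \<open>m\<close> entries are the argument and its last \<open>n\<close> entries the value of
    \<open>f\<close>, so only the definability of the graph is called upon.\<close>
  define Q where "Q t v \<longleftrightarrow> v = 1 \<or> (\<exists>q. length q = m + n \<and> (q \<in> G \<and>
      v = sqrt (\<Sum>j<n. (q ! (m + j))\<^sup>2) \<and> sqrt (\<Sum>i<m. (q ! i - a ! i)\<^sup>2) \<le> 1 \<and>
      \<not> (\<exists>z. length z = m \<and> (z \<in> Z \<and> sqrt (\<Sum>i<m. (q ! i - z ! i)\<^sup>2) < t))))" for t v
  have Q: "v \<in> separated_values m n \<Omega> f a t \<longleftrightarrow> Q t v" for t v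
  proof -
    have len: "length x = m" "length (f x) = n" if "x \<in> \<Omega>" for x
      using f that by (auto simp: definable_fun_def Rn_def)
    have lenz: "length z = m" if "z \<in> Z" for z
      using S_subset[OF Z] that by (auto simp: Rn_def)
    have "v \<in> separated_values m n \<Omega> f a t \<longleftrightarrow> v = 1 \<or> (\<exists>x\<in>\<Omega>. v = lnorm (f x) \<and> ldist x a \<le> 1 \<and>
        \<not> (\<exists>z\<in>Z. ldist x z < t))"
      unfolding separated_values_def Z_def by (auto simp: not_less)
    also have "(\<exists>x\<in>\<Omega>. v = lnorm (f x) \<and> ldist x a \<le> 1 \<and> \<not> (\<exists>z\<in>Z. ldist x z < t)) \<longleftrightarrow>
      (\<exists>q. length q = m + n \<and> (q \<in> G \<and>
      v = sqrt (\<Sum>j<n. (q ! (m + j))\<^sup>2) \<and> sqrt (\<Sum>i<m. (q ! i - a ! i)\<^sup>2) \<le> 1 \<and>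
      \<not> (\<exists>z. length z = m \<and> (z \<in> Z \<and> sqrt (\<Sum>i<m. (q ! i - z ! i)\<^sup>2) < t))))"
      (is "?L \<longleftrightarrow> ?R")
    proof -
      have eqs: "sqrt (\<Sum>j<n. ((x @ f x) ! (m + j))\<^sup>2) = lnorm (f x)"
        "sqrt (\<Sum>i<m. ((x @ f x) ! i - y ! i)\<^sup>2) = ldist x y" if "x \<in> \<Omega>" for x y
        using len[OF that] by (auto simp: lnorm_def ldist_def nth_append)
      have G_ex: "(\<exists>q. length q = m + n \<and> (q \<in> G \<and> P q)) \<longleftrightarrow> (\<exists>x\<in>\<Omega>. P (x @ f x))" for P
      proof -
        have "(\<exists>q\<in>G. P q) \<longleftrightarrow> (\<exists>x\<in>\<Omega>. P (x @ f x))" unfolding G_def lgraph_def by blast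
        then show ?thesis using S_subset[OF G] unfolding Rn_def by blast
      qed
      have Z_ex: "(\<exists>z. length z = m \<and> (z \<in> Z \<and> P z)) \<longleftrightarrow> (\<exists>z\<in>Z. P z)" for P
        using lenz by blast
      show ?thesis unfolding G_ex Z_ex using eqs by simp
    qed
    finally show ?thesis unfolding Q_def .
  qed
  \<comment> \<open>The infimum is expressed as a lower bound that no larger number shares.\<close>
  have "defpred 2 (\<lambda>w. (\<forall>v. Q (w ! 0) v \<longrightarrow> w ! 1 \<le> v) \<and> \<not> (\<exists>u. w ! 1 < u \<and> (\<forall>v. Q (w ! 0) v \<longrightarrow> u \<le> v)))"
    unfolding Q_def
    by (intro defpred_intros defpred_ex_vec defpred_drop_mem[OF G] defpred_drop_mem[OF Z] defterm_intros defterm_sqrt)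
      (auto intro!: defterm_var defterm_nth_drop defterm_nth_drop_take)
  moreover have "(\<forall>v. Q t v \<longrightarrow> s \<le> v) \<and> \<not> (\<exists>u. s < u \<and> (\<forall>v. Q t v \<longrightarrow> u \<le> v)) \<longleftrightarrow>
      s = separation m n \<Omega> f a t" for t s
  proof -
    let ?W = "separated_values m n \<Omega> f a t"
    have ne: "?W \<noteq> {}" by (simp add: separated_values_def)
    have lb: "(\<forall>v. Q t v \<longrightarrow> u \<le> v) \<longleftrightarrow> u \<le> separation m n \<Omega> f a t" for u
      unfolding separation_def Q[symmetric] le_cInf_iff[OF ne bdd_below_separated_values] Ball_def ..
    show ?thesis unfolding lb by (metis leD order.order_iff_strict order_refl)
  qed
  ultimately show ?thesis unfolding definable_real_fun_iff by simp
qed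

end

section \<open>Construction of the comparison function\<close>

theorem mainTheorem3:
  fixes S :: "nat \<Rightarrow> real list set set"
    and p m n :: nat
    and \<Omega> :: "real list set"
    and f :: "real list \<Rightarrow> real list"
    and a :: "real list"
  assumes "o_minimal S"
    and "p > 0"
    and "definable_fun S m n \<Omega> f"
    and "a \<in> gen_zero_set m n \<Omega> f"
  shows "\<exists>r>0. \<exists>\<phi> :: real \<Rightarrow> real.
           (\<forall>t. \<phi> (- t) = - \<phi> t) \<and> strict_mono \<phi> \<and> bij \<phi> \<and>
           definable_real_fun S \<phi> \<and> Ck p \<phi> \<and> p_flat_at_zero p \<phi> \<and>
           (\<forall>x\<in>\<Omega>. ldist x a < r \<longrightarrow>
              lnorm (f x) \<ge> \<phi> (lsetdist x (gen_zero_set m n \<Omega> f)))"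
proof -
  interpret ominimal S by unfold_locales fact
  let ?Z = "gen_zero_set m n \<Omega> f"
  define g where "g = separation m n \<Omega> f a"
  have g_definable: "definable_real_fun S g"
    unfolding g_def by (rule definable_separation[OF assms(3)])
  have g_pos: "g t > 0" if "t > 0" for t
    using assms(3) that unfolding g_def by (intro separation_pos) (auto simp: definable_fun_def)
  have g_mono: "g s \<le> g t" if "s \<le> t" for s t
    unfolding g_def using that by (rule separation_mono)
  have g_le1: "g t \<le> 1" for t unfolding g_def by (rule separation_le_1)
  obtain c where c: "0 < c" "c \<le> 1" "Ck_on p {0<..<c} g"
    by (rule definable_eventually_Ck[OF g_definable])
  \<comment> \<open>\<open>g\<close> is known to be smooth only on the interval from 0 to
    \<open>c\<close>. The map \<open>\<sigma>\<close> sends all nonzero reals into it, is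
    nondecreasing on nonnegative reals, and satisfies \<open>\<sigma> t \<le> t\<close> there
    because \<open>c \<le> 1\<close>.\<close>
  define \<sigma> where "\<sigma> t = c * \<bar>t\<bar> / (1 + \<bar>t\<bar>)" for t
  \<comment> \<open>The factor \<open>t * \<bar>t\<bar> ^ p\<close> makes \<open>\<phi>\<close> odd,
    strictly increasing and unbounded although \<open>g\<close> is only nondecreasing and at most 1.
    It also supplies the flatness at 0.\<close>
  define \<phi> where "\<phi> t = t * \<bar>t\<bar> ^ p * g (\<sigma> t)" for t
  have \<sigma>_range: "0 < \<sigma> t" "\<sigma> t < c" if "t \<noteq> 0" for t
    using c(1) that by (auto simp: \<sigma>_def field_simps add_pos_nonneg)
  have \<sigma>_mono: "\<sigma> s \<le> \<sigma> t" if "0 \<le> s" "s \<le> t" for s t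
    using that c(1) by (simp add: \<sigma>_def field_simps)
  have \<sigma>_le: "\<sigma> t \<le> t" if "0 \<le> t" for t
  proof -
    have "c * t \<le> 1 * t" using c that by (intro mult_right_mono) auto
    also have "\<dots> \<le> t * (1 + t)" using that by (simp add: algebra_simps)
    finally show ?thesis using that by (simp add: \<sigma>_def divide_le_eq)
  qed
  have g\<sigma>_pos: "g (\<sigma> t) > 0" if "t \<noteq> 0" for t using g_pos \<sigma>_range that by blast
  have odd: "\<phi> (- t) = - \<phi> t" for t by (simp add: \<phi>_def \<sigma>_def)
  have def\<phi>: "definable_real_fun S \<phi>"
    unfolding \<phi>_def \<sigma>_def
    by (rule definable_real_funI, intro defterm_intros defterm_fun[OF g_definable]) (auto intro: defterm_var)
  have "Ck_on p (- {0}) \<sigma>"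
    unfolding \<sigma>_def divide_inverse
    by (intro Ck_on_mult Ck_on_const Ck_on_abs Ck_on_compose[OF _ Ck_on_inverse_one_plus]) auto
  then have "Ck_on p (- {0}) (\<lambda>t. g (\<sigma> t))"
    by (intro Ck_on_compose[OF _ c(3)] image_subsetI) (simp_all add: \<sigma>_range open_Compl)
  then have "Ck_on p (- {0}) \<phi>"
    unfolding \<phi>_def by (intro Ck_on_mult Ck_on_id Ck_on_power Ck_on_abs) auto
  moreover have "small_o p \<phi>"
    unfolding small_o_def
  proof (intro allI impI)
    fix q :: real assume "q > 0"
    \<comment> \<open>The radius \<open>q\<close> itself works: \<open>g\<close> is at most 1, so
      one factor \<open>\<bar>t\<bar>\<close> is left over to be bounded by
      \<open>q\<close>.\<close>
    moreover have "\<bar>\<phi> t\<bar> \<le> q * \<bar>t\<bar> ^ p" if "\<bar>t\<bar> < q" for t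
    proof (cases "t = 0")
      case False
      have "\<bar>\<phi> t\<bar> = \<bar>t\<bar> * \<bar>t\<bar> ^ p * g (\<sigma> t)"
        using g\<sigma>_pos[OF False] by (simp add: \<phi>_def abs_mult power_abs)
      also have "\<dots> \<le> \<bar>t\<bar> * \<bar>t\<bar> ^ p * 1" by (intro mult_left_mono g_le1) auto
      also have "\<dots> \<le> q * \<bar>t\<bar> ^ p" using that by (auto intro: mult_right_mono)
      finally show ?thesis .
    qed (use \<open>q > 0\<close> in \<open>simp add: \<phi>_def\<close>)
    ultimately show "\<exists>d>0. \<forall>t. \<bar>t\<bar> < d \<longrightarrow> \<bar>\<phi> t\<bar> \<le> q * \<bar>t\<bar> ^ p" by blast
  qed
  ultimately have Ck: "Ck p \<phi>" and flat: "p_flat_at_zero p \<phi>"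
    using Ck_flat_of_small_o[OF def\<phi>] by blast+
  have pos: "\<phi> t > 0" if "t > 0" for t
    using g\<sigma>_pos[of t] that by (simp add: \<phi>_def)
  have zero: "\<phi> 0 = 0" by (simp add: \<phi>_def)
  have incr: "\<phi> s < \<phi> t" if "0 \<le> s" "s < t" for s t
  proof (cases "s = 0")
    case False
    have "\<phi> s = s ^ Suc p * g (\<sigma> s)" using that by (simp add: \<phi>_def)
    also have "\<dots> \<le> s ^ Suc p * g (\<sigma> t)"
      using that by (intro mult_left_mono g_mono \<sigma>_mono) auto
    also have "\<dots> < t ^ Suc p * g (\<sigma> t)"
      using that g\<sigma>_pos[of t] by (intro mult_strict_right_mono power_strict_mono) auto
    also have "\<dots> = \<phi> t" using that by (simp add: \<phi>_def)
    finally show ?thesis .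
  qed (use zero pos that in simp)
  have smono: "strict_mono \<phi>"
  proof (rule strict_monoI)
    fix s t :: real assume "s < t"
    consider "0 \<le> s" | "t \<le> 0" | "s < 0" "0 < t" using \<open>s < t\<close> by linarith
    then show "\<phi> s < \<phi> t"
    proof cases
      case 2
      then have "\<phi> (- t) < \<phi> (- s)" using \<open>s < t\<close> by (intro incr) auto
      then show ?thesis by (simp add: odd)
    next
      case 3
      then show ?thesis using pos[of t] pos[of "- s"] by (simp add: odd)
    qed (use incr \<open>s < t\<close> in blast)
  qed
  have cont: "continuous_on A \<phi>" for A
  proof -
    obtain k where "p = Suc k" using assms(2) gr0_conv_Suc by blast
    then show ?thesis using Ck
      by (auto intro!: continuous_at_imp_continuous_on differentiable_imp_continuous_within)
  qed
  have surj0: "\<exists>t. \<phi> t = y" if y: "y \<ge> 0" for y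
  proof -
    \<comment> \<open>For \<open>b \<ge> 1\<close> monotonicity gives
      \<open>\<phi> b \<ge> b * g (\<sigma> 1)\<close>, which this choice makes at least
      \<open>y\<close>.\<close>
    define b where "b = max 1 (y / g (\<sigma> 1))"
    have b: "b \<ge> 1" "y \<le> b * g (\<sigma> 1)"
      using g\<sigma>_pos[of 1] by (auto simp: b_def max_def field_simps)
    have "b * g (\<sigma> 1) \<le> (b * \<bar>b\<bar> ^ p) * g (\<sigma> b)"
      using b(1) g\<sigma>_pos[of 1] by (intro mult_mono g_mono \<sigma>_mono) (auto simp: one_le_power)
    then have "y \<le> \<phi> b" using b(2) by (simp add: \<phi>_def)
    then show ?thesis using IVT'[of \<phi> 0 y b] y zero b(1) cont by auto
  qed
  have "\<exists>t. \<phi> t = y" for y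
  proof (cases "y \<ge> 0")
    case False
    then obtain t where "\<phi> t = - y" using surj0[of "- y"] by auto
    then have "\<phi> (- t) = y" by (simp add: odd)
    then show ?thesis by blast
  qed (rule surj0)
  then have "surj \<phi>" unfolding surj_def by metis
  then have bij: "bij \<phi>" using smono strict_mono_imp_inj_on by (auto simp: bij_def)
  \<comment> \<open>The radius 1 is that of the ball in \<open>separated_values\<close>. Since
    \<open>a\<close> lies in the zero set, it also keeps the distance \<open>t\<close> below at most
    1.\<close>
  have ineq: "\<phi> (lsetdist x ?Z) \<le> lnorm (f x)" if x: "x \<in> \<Omega>" "ldist x a < 1" for x
  proof -
    define t where "t = lsetdist x ?Z"
    have bdd: "bdd_below {ldist x z | z. z \<in> ?Z}"
      by (rule bdd_belowI[of _ 0]) (auto simp: ldist_nonneg)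
    have t_le: "t \<le> ldist x z" if "z \<in> ?Z" for z
      unfolding t_def lsetdist_def using that by (intro cInf_lower bdd) auto
    have "0 \<le> t"
      unfolding t_def lsetdist_def using assms(4) by (intro cInf_greatest) (auto simp: ldist_nonneg)
    have "t \<le> 1" using t_le[OF assms(4)] x(2) by simp
    have "\<phi> t \<le> g t"
    proof (cases "t = 0")
      case True
      \<comment> \<open>Positivity of \<open>g\<close> is known only for positive arguments; at 0
        nonnegativity suffices because \<open>\<phi> 0 = 0\<close>.\<close>
      have "0 \<le> g 0"
        unfolding g_def separation_def
        by (rule cInf_greatest) (auto simp: separated_values_def lnorm_nonneg)
      then show ?thesis using True zero by simp
    next
      case False
      have "\<phi> t = t ^ Suc p * g (\<sigma> t)" using \<open>0 \<le> t\<close> by (simp add: \<phi>_def)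
      \<comment> \<open>The power is at most 1 because \<open>t \<le> 1\<close>, and
        \<open>\<sigma> t \<le> t\<close> lets monotonicity of \<open>g\<close> remove the
        reparametrisation.\<close>
      also have "\<dots> \<le> 1 * g t"
        using \<open>0 \<le> t\<close> \<open>t \<le> 1\<close> False g\<sigma>_pos[of t] \<sigma>_le[of t]
        by (intro mult_mono power_le_one g_mono) auto
      finally show ?thesis by simp
    qed
    also have "g t \<le> lnorm (f x)"
      unfolding g_def using x t_le by (intro separation_le) auto
    finally show ?thesis unfolding t_def .
  qed
  show ?thesis
    using odd smono bij def\<phi> Ck flat ineq by (intro exI[of _ 1] conjI exI[of _ \<phi>]) auto
qed

end
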